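(* Let $\{s_k\}_{k\in\mathbb{N}_0}$ be a positive sequence, let $d\in\mathbb{N}$ and $\ell_0\in 2\mathbb{N}_0$, and let $\tilde s_k=s_{kd+\ell_0}$. Let $\sigma$ be a moment solution of $\{s_k\}$. If the moment problem for $\{\tilde s_k\}$ is indeterminate, then there exists $\phi\in N$ such that for all $\lambda\in\mathbb{C}$ with $\operatorname{Im}\lambda>0$, $$\int_{-\infty}^{\infty}\frac{x^{\ell_0}\,d\sigma(x)}{x^d-\lambda}=-\frac{\tilde A(\lambda)\phi(\lambda)-\tilde C(\lambda)}{\tilde B(\lambda)\phi(\lambda)-\tilde D(\lambda)},$$ where $\tilde A,\tilde B,\tilde C,\tilde D$ is the Nevanlinna matrix of the indeterminate moment problem for $\{\tilde s_k\}$ (when $\phi\equiv\infty$ the right-hand side is read as $-\tilde A(\lambda)/\tilde B(\lambda)$).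
   Context: A sequence of real numbers is positive if all its Hankel matrices $(s_{i+j})_{i,j=0}^n$ are positive semidefinite; a moment solution is a non-decreasing $\sigma$ on $\mathbb{R}$ with $s_k=\int x^k\,d\sigma(x)$; the problem is indeterminate if it has more than one moment solution (identifying functions whose difference is constant at its continuity points). For an indeterminate positive sequence $\{\tilde s_k\}$ with a moment solution $\tilde\sigma$, let $P_k$ be the orthonormal polynomials (positive leading coefficient) with respect to $d\tilde\sigma$, and $Q_k(z)=\int\frac{P_k(z)-P_k(x)}{z-x}\,d\tilde\sigma(x)$ the polynomials of the second kind. The Nevanlinna matrix consists of the entire functions $\tilde A(z)=z\sum_{k\ge0}Q_k(0)Q_k(z)$, $\tilde B(z)=-1+z\sum_{k\ge0}Q_k(0)P_k(z)$, $\tilde C(z)=1+z\sum_{k\ge0}P_k(0)Q_k(z)$, $\tilde D(z)=z\sum_{k\ge0}P_k(0)P_k(z)$. $N$ denotes the class of functions holomorphic in the upper half-plane with nonnegative imaginary part, together with the constant $\infty$. *)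

theory Defs
  imports "HOL-Analysis.Analysis" "HOL-Computational_Algebra.Polynomial"
begin

definition positive_seq :: "(nat \<Rightarrow> real) \<Rightarrow> bool" where
  "positive_seq s \<longleftrightarrow>
     (\<forall>n. \<forall>c :: nat \<Rightarrow> real. 0 \<le> (\<Sum>i\<le>n. \<Sum>j\<le>n. c i * c j * s (i + j)))"

text \<open>A moment solution, i.e. a non-decreasing function on the real line modulo additive
  constants, is represented by the finite Borel measure it induces (Lebesgue-Stieltjes).\<close>
definition moment_solution :: "(nat \<Rightarrow> real) \<Rightarrow> real measure \<Rightarrow> bool" where
  "moment_solution s \<mu> \<longleftrightarrow>
     sets \<mu> = sets borel \<and> finite_measure \<mu> \<and>
     (\<forall>k. integrable \<mu> (\<lambda>x. x ^ k) \<and> (\<integral>x. x ^ k \<partial>\<mu>) = s k)"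

definition indeterminate :: "(nat \<Rightarrow> real) \<Rightarrow> bool" where
  "indeterminate s \<longleftrightarrow>
     (\<exists>\<mu>1 \<mu>2. moment_solution s \<mu>1 \<and> moment_solution s \<mu>2 \<and> \<mu>1 \<noteq> \<mu>2)"

definition orthonormal_polys :: "real measure \<Rightarrow> (nat \<Rightarrow> real poly) \<Rightarrow> bool" where
  "orthonormal_polys \<mu> P \<longleftrightarrow>
     (\<forall>k. degree (P k) = k \<and> lead_coeff (P k) > 0) \<and>
     (\<forall>j k. (\<integral>x. poly (P j) x * poly (P k) x \<partial>\<mu>) = (if j = k then 1 else 0))"

definition cpoly :: "real poly \<Rightarrow> complex \<Rightarrow> complex" where
  "cpoly p z = poly (map_poly complex_of_real p) z"

text \<open>The difference quotient (p(z) - p(x))/(z - x), written out as the polynomial it is.\<close>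
definition diff_quot :: "real poly \<Rightarrow> complex \<Rightarrow> real \<Rightarrow> complex" where
  "diff_quot p z x =
     (\<Sum>i\<le>degree p. complex_of_real (coeff p i) *
        (\<Sum>j<i. z ^ j * complex_of_real x ^ (i - 1 - j)))"

definition second_kind :: "real measure \<Rightarrow> real poly \<Rightarrow> complex \<Rightarrow> complex" where
  "second_kind \<mu> p z = (\<integral>x. diff_quot p z x \<partial>\<mu>)"

text \<open>Data attached to an (indeterminate) positive sequence: a moment solution and its
  orthonormal polynomials (which depend only on the moments).\<close>
definition some_solution :: "(nat \<Rightarrow> real) \<Rightarrow> real measure" where
  "some_solution s = (SOME \<mu>. moment_solution s \<mu>)"

definition onp :: "(nat \<Rightarrow> real) \<Rightarrow> nat \<Rightarrow> real poly" where
  "onp s = (THE P. orthonormal_polys (some_solution s) P)"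

definition onpP :: "(nat \<Rightarrow> real) \<Rightarrow> nat \<Rightarrow> complex \<Rightarrow> complex" where
  "onpP s k z = cpoly (onp s k) z"

definition onpQ :: "(nat \<Rightarrow> real) \<Rightarrow> nat \<Rightarrow> complex \<Rightarrow> complex" where
  "onpQ s k z = second_kind (some_solution s) (onp s k) z"

definition nevA :: "(nat \<Rightarrow> real) \<Rightarrow> complex \<Rightarrow> complex" where
  "nevA s z = z * (\<Sum>k. onpQ s k 0 * onpQ s k z)"

definition nevB :: "(nat \<Rightarrow> real) \<Rightarrow> complex \<Rightarrow> complex" where
  "nevB s z = -1 + z * (\<Sum>k. onpQ s k 0 * onpP s k z)"

definition nevC :: "(nat \<Rightarrow> real) \<Rightarrow> complex \<Rightarrow> complex" where
  "nevC s z = 1 + z * (\<Sum>k. onpP s k 0 * onpQ s k z)"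

definition nevD :: "(nat \<Rightarrow> real) \<Rightarrow> complex \<Rightarrow> complex" where
  "nevD s z = z * (\<Sum>k. onpP s k 0 * onpP s k z)"

text \<open>The class N: holomorphic functions on the upper half-plane with nonnegative
  imaginary part, together with the constant \<infinity> (represented by None).\<close>
definition nevanlinna_class :: "(complex \<Rightarrow> complex) option \<Rightarrow> bool" where
  "nevanlinna_class \<phi> = (case \<phi> of None \<Rightarrow> True
      | Some f \<Rightarrow> f holomorphic_on {z. 0 < Im z} \<and> (\<forall>z. 0 < Im z \<longrightarrow> 0 \<le> Im (f z)))"

definition nev_transform ::
  "(nat \<Rightarrow> real) \<Rightarrow> (complex \<Rightarrow> complex) option \<Rightarrow> complex \<Rightarrow> complex" where
  "nev_transform s \<phi> z = (case \<phi> of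
       None \<Rightarrow> - (nevA s z / nevB s z)
     | Some f \<Rightarrow> - ((nevA s z * f z - nevC s z) / (nevB s z * f z - nevD s z)))"

end

theory Submission
  imports Defs "HOL-Complex_Analysis.Complex_Analysis"
begin

text \<open>The image of \<open>x\<^sup>l d\<sigma>\<close> under \<open>x \<mapsto> x\<^sup>d\<close> solves the moment problem for \<open>s\<^bsub>kd+l\<^esub>\<close>, so it suffices to
  represent the Stieltjes transform \<open>F(z) = \<integral> d\<mu>(x) / (x - z)\<close> of an arbitrary solution \<open>\<mu>\<close> of an
  indeterminate problem. The Fourier coefficients of \<open>1 / (x - z)\<close> are \<open>F P\<^sub>k + Q\<^sub>k\<close>, so Bessel's
  inequality gives \<open>Im z \<Sum>\<^sub>k |F P\<^sub>k + Q\<^sub>k|\<^sup>2 \<le> Im F\<close>. Two solutions with different transforms at a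
  point force \<open>(P\<^sub>k)\<close> and \<open>(Q\<^sub>k)\<close> to be square summable there, and a discrete Gronwall argument for
  the three-term recurrence extends this locally uniformly to the plane, so that \<open>A\<close>, \<open>B\<close>, \<open>C\<close>, \<open>D\<close> are
  entire. With \<open>U = F B + A\<close> and \<open>V = F D + C\<close>, the Christoffel-Darboux (Green) identity yields
  \<open>A D - B C = 1\<close> and \<open>Im (V cnj U) = Im F - Im z \<Sum>\<^sub>k |F P\<^sub>k + Q\<^sub>k|\<^sup>2 \<ge> 0\<close>. Hence \<open>\<phi> = V / U\<close> has nonnegative
  imaginary part and solves the required equation; if \<open>U\<close> has a zero, the open mapping theorem
  applied to \<open>U / V\<close> shows \<open>U = 0\<close> identically, which is the case \<open>\<phi> = \<infinity>\<close>.\<close>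

section \<open>Stieltjes transforms\<close>

definition stieltjes :: "real measure \<Rightarrow> complex \<Rightarrow> complex" where
  "stieltjes \<mu> z = (\<integral>x. 1 / (complex_of_real x - z) \<partial>\<mu>)"

lemma of_real_neq_nonreal: "Im z \<noteq> 0 \<Longrightarrow> complex_of_real x - z \<noteq> 0"
  by (auto simp: complex_eq_iff)

lemma norm_of_real_diff_ge: "\<bar>Im z\<bar> \<le> norm (complex_of_real x - z)"
  using abs_Im_le_cmod[of "complex_of_real x - z"] by simp

lemma norm_cauchy_kernel_le:
  assumes "Im z \<noteq> 0"
  shows "norm (1 / (complex_of_real x - z)) \<le> 1 / \<bar>Im z\<bar>"
  using norm_of_real_diff_ge[of z x] assms by (simp add: norm_divide frac_le)

lemma borel_cauchy_kernel:
  assumes "sets \<mu> = sets borel"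
  shows "(\<lambda>x. 1 / (complex_of_real x - z)) \<in> borel_measurable \<mu>"
proof -
  have "(\<lambda>x. 1 / (complex_of_real x - z)) \<in> borel_measurable borel" by measurable
  then show ?thesis using assms measurable_cong_sets by blast
qed

lemma integrable_cauchy_kernel:
  assumes "finite_measure \<mu>" "sets \<mu> = sets borel" "Im z \<noteq> 0"
  shows "integrable \<mu> (\<lambda>x. 1 / (complex_of_real x - z))"
  using norm_cauchy_kernel_le[OF assms(3)] borel_cauchy_kernel[OF assms(2)]
  by (intro finite_measure.integrable_const_bound[OF assms(1), of _ "1 / \<bar>Im z\<bar>"]) auto

text \<open>1/w is \<open>cnj w\<close> over |w|^2. This makes Im F(z) / Im z the squared L2 norm of
  the kernel, the quantity that bounds the Fourier coefficients in Bessel's inequality.\<close>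

lemma Im_cauchy_kernel:
  "Im (1 / (complex_of_real x - z)) = Im z * (norm (1 / (complex_of_real x - z)))\<^sup>2"
proof -
  have "Im (1 / (complex_of_real x - z)) = Im z / ((x - Re z)\<^sup>2 + (Im z)\<^sup>2)"
    by (simp add: Im_divide)
  also have "(x - Re z)\<^sup>2 + (Im z)\<^sup>2 = (norm (complex_of_real x - z))\<^sup>2"
    by (simp add: cmod_power2)
  finally show ?thesis by (simp add: norm_divide power_divide)
qed

lemma Im_stieltjes:
  assumes "finite_measure \<mu>" "sets \<mu> = sets borel" "Im z \<noteq> 0"
  shows "Im (stieltjes \<mu> z) = Im z * (\<integral>x. (norm (1 / (complex_of_real x - z)))\<^sup>2 \<partial>\<mu>)"
proof -
  have "Im (stieltjes \<mu> z) = (\<integral>x. Im (1 / (complex_of_real x - z)) \<partial>\<mu>)"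
    unfolding stieltjes_def using integral_Im[OF integrable_cauchy_kernel[OF assms]] by simp
  then show ?thesis by (simp only: Im_cauchy_kernel integral_mult_right_zero)
qed

text \<open>The difference quotient of the kernel between w and z is the product of the two kernels,
  so dominated convergence differentiates under the integral.\<close>

lemma holomorphic_stieltjes:
  assumes fin: "finite_measure \<mu>" and sets: "sets \<mu> = sets borel"
  shows "stieltjes \<mu> holomorphic_on {z. 0 < Im z}"
proof (rule holomorphic_onI)
  let ?k = "\<lambda>z x. 1 / (complex_of_real x - z)"
  fix z :: complex assume "z \<in> {z. 0 < Im z}"
  then have z: "0 < Im z" by simp
  have "((\<lambda>w. (stieltjes \<mu> w - stieltjes \<mu> z) / (w - z)) \<longlongrightarrow> (\<integral>x. ?k z x * ?k z x \<partial>\<mu>)) (at z)"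
  proof (subst tendsto_at_iff_sequentially, intro allI impI)
    fix X :: "nat \<Rightarrow> complex" assume X: "\<forall>i. X i \<in> UNIV - {z}" "X \<longlonglongrightarrow> z"
    have "(\<lambda>i. Im (X i)) \<longlonglongrightarrow> Im z" by (intro tendsto_intros X)
    then have "\<forall>\<^sub>F i in sequentially. Im (X i) > Im z / 2"
      by (rule order_tendstoD) (use z in simp)
    then obtain N where N: "\<And>i. i \<ge> N \<Longrightarrow> Im (X i) > Im z / 2"
      by (auto simp: eventually_sequentially)
    \<comment> \<open>The first N terms are dropped because dominated convergence needs one bound
      for all indices, hence a common distance from the real line.\<close>
    have N': "Im (X (i + N)) > Im z / 2" for i using N by simp
    have quot: "(stieltjes \<mu> (X (i + N)) - stieltjes \<mu> z) / (X (i + N) - z)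
        = (\<integral>x. ?k (X (i + N)) x * ?k z x \<partial>\<mu>)" for i
    proof -
      let ?w = "X (i + N)"
      have w: "Im ?w \<noteq> 0" using N'[of i] z by linarith
      have wz: "?w - z \<noteq> 0" using X(1) by auto
      have "(stieltjes \<mu> ?w - stieltjes \<mu> z) / (?w - z) = (\<integral>x. ?k ?w x - ?k z x \<partial>\<mu>) / (?w - z)"
        unfolding stieltjes_def
        using integrable_cauchy_kernel[OF fin sets] z w by simp
      also have "\<dots> = (\<integral>x. (?k ?w x - ?k z x) / (?w - z) \<partial>\<mu>)" by simp
      also have "\<dots> = (\<integral>x. ?k ?w x * ?k z x \<partial>\<mu>)"
      proof (intro Bochner_Integration.integral_cong refl)
        fix x
        have "complex_of_real x - ?w \<noteq> 0" "complex_of_real x - z \<noteq> 0"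
          using of_real_neq_nonreal w z by auto
        then show "(?k ?w x - ?k z x) / (?w - z) = ?k ?w x * ?k z x"
          using wz by (simp add: divide_simps)
      qed
      finally show ?thesis .
    qed
    have "(\<lambda>i. \<integral>x. ?k (X (i + N)) x * ?k z x \<partial>\<mu>) \<longlonglongrightarrow> (\<integral>x. ?k z x * ?k z x \<partial>\<mu>)"
    proof (rule integral_dominated_convergence[where w="\<lambda>_. 2 / Im z * (1 / Im z)"])
      show "AE x in \<mu>. (\<lambda>i. ?k (X (i + N)) x * ?k z x) \<longlonglongrightarrow> ?k z x * ?k z x"
      proof (rule AE_I2)
        fix x
        have "(\<lambda>i. X (i + N)) \<longlonglongrightarrow> z" by (rule LIMSEQ_ignore_initial_segment[OF X(2)])
        then show "(\<lambda>i. ?k (X (i + N)) x * ?k z x) \<longlonglongrightarrow> ?k z x * ?k z x"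
          using of_real_neq_nonreal[of z x] z by (intro tendsto_intros) auto
      qed
      show "AE x in \<mu>. norm (?k (X (i + N)) x * ?k z x) \<le> 2 / Im z * (1 / Im z)" for i
      proof (rule AE_I2)
        fix x
        have "norm (?k (X (i + N)) x) \<le> 1 / \<bar>Im (X (i + N))\<bar>"
          using N'[of i] z by (intro norm_cauchy_kernel_le) linarith
        also have "\<dots> \<le> 2 / Im z" using N'[of i] z by (simp add: field_simps)
        finally have "norm (?k (X (i + N)) x) \<le> 2 / Im z" .
        moreover have "norm (?k z x) \<le> 1 / Im z" using norm_cauchy_kernel_le[of z x] z by simp
        ultimately show "norm (?k (X (i + N)) x * ?k z x) \<le> 2 / Im z * (1 / Im z)"
          unfolding norm_mult using z by (intro mult_mono) auto
      qed
    qed (auto intro!: borel_measurable_times borel_cauchy_kernel[OF sets]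
        simp: finite_measure.integrable_const[OF fin] simp del: times_divide_eq_left times_divide_eq_right)
    then have "(\<lambda>i. (stieltjes \<mu> (X (i + N)) - stieltjes \<mu> z) / (X (i + N) - z))
        \<longlonglongrightarrow> (\<integral>x. ?k z x * ?k z x \<partial>\<mu>)"
      by (simp only: quot)
    then show "((\<lambda>w. (stieltjes \<mu> w - stieltjes \<mu> z) / (w - z)) \<circ> X)
        \<longlonglongrightarrow> (\<integral>x. ?k z x * ?k z x \<partial>\<mu>)"
      unfolding comp_def by (rule LIMSEQ_offset)
  qed
  then have "(stieltjes \<mu> has_field_derivative (\<integral>x. ?k z x * ?k z x \<partial>\<mu>)) (at z)"
    by (simp add: has_field_derivative_iff)
  then show "stieltjes \<mu> field_differentiable at z within {z. 0 < Im z}"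
    using field_differentiable_at_within field_differentiable_def by blast
qed

text \<open>At height y, Im F is pi times the Poisson integral of \<mu>. Fubini moves the
  integration over t inside, where arctan ((t - x) / y) is an antiderivative of the kernel.\<close>

lemma integral_Im_stieltjes:
  fixes a b y :: real
  assumes fin: "finite_measure \<mu>" and sets: "sets \<mu> = sets borel" and y: "0 < y" and ab: "a \<le> b"
  shows "(\<integral>t. Im (stieltjes \<mu> (Complex t y)) * indicator {a..b} t \<partial>lborel)
     = (\<integral>x. arctan ((b - x) / y) - arctan ((a - x) / y) \<partial>\<mu>)"
proof -
  interpret finite_measure \<mu> by fact
  interpret pair_sigma_finite lborel \<mu> ..
  define f where "f t x = y / ((t - x)\<^sup>2 + y\<^sup>2) * indicator {a..b} t" for t x :: real
  have pos: "(t - x)\<^sup>2 + y\<^sup>2 > 0" for t x using y by (intro add_nonneg_pos) auto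
  have ker: "Im (1 / (complex_of_real x - Complex t y)) = y / ((t - x)\<^sup>2 + y\<^sup>2)" for t x
    by (simp add: Im_divide power2_commute)
  have inner_x: "(\<integral>x. f t x \<partial>\<mu>) = Im (stieltjes \<mu> (Complex t y)) * indicator {a..b} t" for t
  proof -
    have "Im (stieltjes \<mu> (Complex t y)) = (\<integral>x. y / ((t - x)\<^sup>2 + y\<^sup>2) \<partial>\<mu>)"
      unfolding stieltjes_def
      using integral_Im[OF integrable_cauchy_kernel[OF fin sets, of "Complex t y"]] y
      by (simp add: ker)
    then show ?thesis unfolding f_def by (simp only: integral_mult_left_zero)
  qed
  have inner_t: "(\<integral>t. f t x \<partial>lborel) = arctan ((b - x) / y) - arctan ((a - x) / y)" for x
    unfolding f_def
  proof (rule integral_FTC_Icc_real[OF ab])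
    fix t
    show "((\<lambda>t. arctan ((t - x) / y)) has_real_derivative y / ((t - x)\<^sup>2 + y\<^sup>2)) (at t)"
      using y pos[of t x]
      by (auto intro!: derivative_eq_intros simp: divide_simps power2_eq_square)
    show "isCont (\<lambda>t. y / ((t - x)\<^sup>2 + y\<^sup>2)) t"
      using pos[of t x] by (intro continuous_intros) auto
  qed
  have m: "(\<lambda>(t, x). f t x) \<in> borel_measurable (lborel \<Otimes>\<^sub>M \<mu>)"
  proof -
    have "(\<lambda>(t, x). f t x) \<in> borel_measurable (borel \<Otimes>\<^sub>M borel)"
      unfolding f_def by measurable
    then show ?thesis
      using measurable_cong_sets[OF sets_pair_measure_cong[of lborel borel \<mu> borel] refl] sets
      by (metis sets_lborel)
  qed
  \<comment> \<open>Joint integrability: the integrand lies between 0 and 1/y, lives on [a, b] in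
    the variable t, and \<mu> is finite.\<close>
  have "integrable (lborel \<Otimes>\<^sub>M \<mu>) (\<lambda>(t, x). f t x)"
  proof (rule Fubini_integrable)
    show "(\<lambda>(t, x). f t x) \<in> borel_measurable (lborel \<Otimes>\<^sub>M \<mu>)" by fact
    have nn: "f t x \<ge> 0" for t x using y pos[of t x] by (simp add: f_def)
    have bd: "f t x \<le> 1 / y * indicator {a..b} t" for t x
    proof -
      have "y / ((t - x)\<^sup>2 + y\<^sup>2) \<le> y / y\<^sup>2" using y by (intro divide_left_mono) (auto intro!: mult_pos_pos pos)
      then show ?thesis using y unfolding f_def by (intro mult_right_mono) (auto simp: power2_eq_square)
    qed
    have int: "integrable \<mu> (f t)" for t
    proof (rule integrable_const_bound)
      show "AE x in \<mu>. norm (f t x) \<le> 1 / y * indicator {a..b} t"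
        using nn bd by (intro AE_I2) (simp add: abs_of_nonneg del: times_divide_eq_left)
      show "f t \<in> borel_measurable \<mu>"
        unfolding measurable_cong_sets[OF sets refl] f_def by measurable
    qed
    show "AE t in lborel. integrable \<mu> (\<lambda>x. case (t, x) of (t, x) \<Rightarrow> f t x)"
      using int by simp
    have "integrable lborel (\<lambda>t. \<integral>x. f t x \<partial>\<mu>)"
    proof (rule Bochner_Integration.integrable_bound)
      show "integrable lborel (\<lambda>t. (1 / y * measure \<mu> (space \<mu>)) * indicator {a..b} t :: real)"
        by (intro integrable_mult_right integrable_real_indicator) (auto simp: emeasure_lborel_Icc_eq)
      show "(\<lambda>t. \<integral>x. f t x \<partial>\<mu>) \<in> borel_measurable lborel"
        using m by (simp add: case_prod_beta' borel_measurable_lebesgue_integral)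
      have "(\<integral>x. f t x \<partial>\<mu>) \<le> (\<integral>x. 1 / y * indicator {a..b} t \<partial>\<mu>)" for t
        by (intro integral_mono int bd) simp
      moreover have "(\<integral>x. f t x \<partial>\<mu>) \<ge> 0" for t using nn by (intro integral_nonneg_AE) simp
      ultimately show "AE t in lborel. norm (\<integral>x. f t x \<partial>\<mu>)
          \<le> norm ((1 / y * measure \<mu> (space \<mu>)) * indicator {a..b} t :: real)"
        using y by (intro AE_I2) (simp add: mult_ac)
    qed
    then show "integrable lborel (\<lambda>t. \<integral>x. norm (case (t, x) of (t, x) \<Rightarrow> f t x) \<partial>\<mu>)"
      using nn by simp
  qed
  then have "(\<integral>x. (\<integral>t. f t x \<partial>lborel) \<partial>\<mu>) = (\<integral>t. (\<integral>x. f t x \<partial>\<mu>) \<partial>lborel)"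
    by (rule Fubini_integral)
  then show ?thesis by (simp add: inner_x inner_t)
qed

text \<open>Stieltjes inversion: the limits \<open>y \<rightarrow> 0\<close>, \<open>a \<rightarrow> -\<infinity>\<close>, \<open>b' \<down> b\<close> of the previous identity
  recover the tails of the measure.\<close>

lemma stieltjes_inj:
  assumes fin: "finite_measure \<mu>" "finite_measure \<nu>"
    and sets: "sets \<mu> = sets borel" "sets \<nu> = sets borel"
    and mass: "measure \<mu> UNIV = measure \<nu> UNIV"
    and eq: "\<And>z. 0 < Im z \<Longrightarrow> stieltjes \<mu> z = stieltjes \<nu> z"
  shows "\<mu> = \<nu>"
proof -
  \<comment> \<open>As y = 1/(n+1) tends to 0, arctan (c/y) tends to pi/2 * sgn c. Since sgn 0 = 0,
    for a < b an atom at an endpoint counts with half its weight.\<close>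
  have lims: "(\<lambda>n. \<integral>t. Im (stieltjes M (Complex t (inverse (real (Suc n))))) * indicator {a..b} t \<partial>lborel)
      \<longlonglongrightarrow> (\<integral>x. pi / 2 * (sgn (b - x) - sgn (a - x)) \<partial>M)"
    if M: "finite_measure M" "sets M = sets borel" and ab: "a \<le> b" for M a b
  proof -
    have at: "(\<lambda>n. arctan (c / inverse (real (Suc n)))) \<longlonglongrightarrow> pi / 2 * sgn c" for c :: real
    proof -
      have Suc_top: "filterlim (\<lambda>n. real (Suc n)) at_top sequentially"
        by (rule filterlim_compose[OF filterlim_real_sequentially filterlim_Suc])
      have scale: "c / inverse (real (Suc n)) = c * real (Suc n)" for n
        by (simp add: field_simps)
      consider "c = 0" | "c > 0" | "c < 0" by linarith
      then show ?thesis
      proof cases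
        case 2
        have "filterlim (\<lambda>n. c * real (Suc n)) at_top sequentially"
          by (rule filterlim_tendsto_pos_mult_at_top[OF tendsto_const 2 Suc_top])
        from filterlim_compose[OF tendsto_arctan_at_top this] 2 show ?thesis
          unfolding scale by simp
      next
        case 3
        have "filterlim (\<lambda>n. c * real (Suc n)) at_bot sequentially"
          by (rule filterlim_tendsto_neg_mult_at_bot[OF tendsto_const 3 Suc_top])
        from filterlim_compose[OF tendsto_arctan_at_bot this] 3 show ?thesis
          unfolding scale by simp
      qed simp
    qed
    have "(\<lambda>n. \<integral>x. arctan ((b - x) / inverse (real (Suc n))) - arctan ((a - x) / inverse (real (Suc n))) \<partial>M)
        \<longlonglongrightarrow> (\<integral>x. pi / 2 * (sgn (b - x) - sgn (a - x)) \<partial>M)"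
    proof (rule integral_dominated_convergence[where w="\<lambda>_. pi"])
      show "AE x in M. (\<lambda>n. arctan ((b - x) / inverse (real (Suc n))) - arctan ((a - x) / inverse (real (Suc n))))
          \<longlonglongrightarrow> pi / 2 * (sgn (b - x) - sgn (a - x))"
        unfolding right_diff_distrib by (intro AE_I2 tendsto_diff at)
      show "AE x in M. norm (arctan ((b - x) / inverse (real (Suc n))) - arctan ((a - x) / inverse (real (Suc n)))) \<le> pi" for n
      proof (rule AE_I2)
        fix x
        show "norm (arctan ((b - x) / inverse (real (Suc n))) - arctan ((a - x) / inverse (real (Suc n)))) \<le> pi"
          using arctan_bounded[of "(b - x) / inverse (real (Suc n))"]
            arctan_bounded[of "(a - x) / inverse (real (Suc n))"]
          unfolding real_norm_def by linarith
      qed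
      show "(\<lambda>x. arctan ((b - x) / inverse (real (Suc n))) - arctan ((a - x) / inverse (real (Suc n)))) \<in> borel_measurable M" for n
        unfolding measurable_cong_sets[OF M(2) refl] by measurable
      show "(\<lambda>x. pi / 2 * (sgn (b - x) - sgn (a - x))) \<in> borel_measurable M"
        unfolding measurable_cong_sets[OF M(2) refl] by measurable
    qed (use M in \<open>simp add: finite_measure.integrable_const\<close>)
    then show ?thesis
      by (subst integral_Im_stieltjes[OF M _ ab]) auto
  qed
  have intv: "(\<integral>x. pi / 2 * (sgn (b - x) - sgn (a - x)) \<partial>\<mu>) = (\<integral>x. pi / 2 * (sgn (b - x) - sgn (a - x)) \<partial>\<nu>)"
    if "a \<le> b" for a b
  proof (rule LIMSEQ_unique[OF lims[OF fin(1) sets(1) that]])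
    show "(\<lambda>n. \<integral>t. Im (stieltjes \<mu> (Complex t (inverse (real (Suc n))))) * indicator {a..b} t \<partial>lborel)
      \<longlonglongrightarrow> (\<integral>x. pi / 2 * (sgn (b - x) - sgn (a - x)) \<partial>\<nu>)"
      using lims[OF fin(2) sets(2) that] by (simp add: eq)
  qed
  have bint: "integrable M (\<lambda>x. sgn (b - x))" if M: "finite_measure M" "sets M = sets borel" for M and b :: real
  proof (rule finite_measure.integrable_const_bound[OF M(1), of _ 1])
    show "(\<lambda>x. sgn (b - x)) \<in> borel_measurable M"
      unfolding measurable_cong_sets[OF M(2) refl] by measurable
  qed (auto simp: sgn_if)
  have diff: "(\<integral>x. sgn (b - x) \<partial>\<mu>) - (\<integral>x. sgn (a - x) \<partial>\<mu>) = (\<integral>x. sgn (b - x) \<partial>\<nu>) - (\<integral>x. sgn (a - x) \<partial>\<nu>)"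
    if "a \<le> b" for a b
    using intv[OF that] bint[OF fin(1) sets(1)] bint[OF fin(2) sets(2)] by simp
  have left: "(\<lambda>n. \<integral>x. sgn (- real n - x) \<partial>M) \<longlonglongrightarrow> - measure M UNIV"
    if M: "finite_measure M" "sets M = sets borel" for M
  proof -
    have "(\<lambda>n. \<integral>x. sgn (- real n - x) \<partial>M) \<longlonglongrightarrow> (\<integral>x. - 1 \<partial>M)"
    proof (rule integral_dominated_convergence[where w="\<lambda>_. 1"])
      show "AE x in M. (\<lambda>n. sgn (- real n - x)) \<longlonglongrightarrow> - 1"
      proof (rule AE_I2)
        fix x
        obtain N where N: "real N > - x" using reals_Archimedean2 by blast
        show "(\<lambda>n. sgn (- real n - x)) \<longlonglongrightarrow> - 1"
          by (rule tendsto_eventually, rule eventually_sequentiallyI[of N]) (use N in \<open>auto simp: sgn_if\<close>)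
      qed
      show "(\<lambda>x. sgn (- real n - x)) \<in> borel_measurable M" for n
        unfolding measurable_cong_sets[OF M(2) refl] by measurable
    qed (use M in \<open>auto simp: finite_measure.integrable_const sgn_if\<close>)
    moreover have "space M = UNIV" using sets_eq_imp_space_eq[OF M(2)] by simp
    ultimately show ?thesis by simp
  qed
  \<comment> \<open>By \<open>diff\<close> the discrepancy between the two measures is the same at b
    and at every -n <= b; by \<open>left\<close> it tends to the difference of the total masses up
    to sign, which is 0.\<close>
  have full: "(\<integral>x. sgn (b - x) \<partial>\<mu>) = (\<integral>x. sgn (b - x) \<partial>\<nu>)" for b
  proof -
    have "(\<lambda>n. (\<integral>x. sgn (- real n - x) \<partial>\<mu>) - (\<integral>x. sgn (- real n - x) \<partial>\<nu>))
        \<longlonglongrightarrow> - measure \<mu> UNIV - - measure \<nu> UNIV"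
      by (intro tendsto_diff left fin sets)
    moreover obtain N where N: "real N > - b" using reals_Archimedean2 by blast
    then have "\<forall>\<^sub>F n in sequentially. (\<integral>x. sgn (- real n - x) \<partial>\<mu>) - (\<integral>x. sgn (- real n - x) \<partial>\<nu>)
        = (\<integral>x. sgn (b - x) \<partial>\<mu>) - (\<integral>x. sgn (b - x) \<partial>\<nu>)"
    proof (intro eventually_sequentiallyI[of N])
      fix n assume "N \<le> n"
      then have "- real n \<le> b" using N by linarith
      from diff[OF this] show "(\<integral>x. sgn (- real n - x) \<partial>\<mu>) - (\<integral>x. sgn (- real n - x) \<partial>\<nu>)
        = (\<integral>x. sgn (b - x) \<partial>\<mu>) - (\<integral>x. sgn (b - x) \<partial>\<nu>)" by simp
    qed
    then have "(\<lambda>n. (\<integral>x. sgn (- real n - x) \<partial>\<mu>) - (\<integral>x. sgn (- real n - x) \<partial>\<nu>))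
        \<longlonglongrightarrow> (\<integral>x. sgn (b - x) \<partial>\<mu>) - (\<integral>x. sgn (b - x) \<partial>\<nu>)"
      by (rule tendsto_eventually)
    ultimately show ?thesis using LIMSEQ_unique mass by fastforce
  qed
  \<comment> \<open>Approaching b from the right gives the atom at b the value 1 instead of sgn 0 =
    0, so the limit sees exactly the open half-line beyond b.\<close>
  have right: "(\<lambda>n. \<integral>x. sgn (b + inverse (real (Suc n)) - x) \<partial>M) \<longlonglongrightarrow> measure M UNIV - 2 * measure M {b<..}"
    if M: "finite_measure M" "sets M = sets borel" for M b
  proof -
    have lim: "(\<lambda>n. \<integral>x. sgn (b + inverse (real (Suc n)) - x) \<partial>M) \<longlonglongrightarrow> (\<integral>x. 1 - 2 * indicator {b<..} x \<partial>M)"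
    proof (rule integral_dominated_convergence[where w="\<lambda>_. 1"])
      show "AE x in M. (\<lambda>n. sgn (b + inverse (real (Suc n)) - x)) \<longlonglongrightarrow> 1 - 2 * indicator {b<..} x"
      proof (rule AE_I2)
        fix x
        show "(\<lambda>n. sgn (b + inverse (real (Suc n)) - x)) \<longlonglongrightarrow> 1 - 2 * indicator {b<..} x"
        proof (cases "x \<le> b")
          case True
          then have "b + inverse (real (Suc n)) - x > 0" for n
            using inverse_positive_iff_positive[of "real (Suc n)"] by linarith
          then have "sgn (b + inverse (real (Suc n)) - x) = 1" for n by (rule sgn_pos)
          then show ?thesis using True by simp
        next
          case False
          then have "\<forall>\<^sub>F n in sequentially. inverse (real (Suc n)) < x - b"
            by (intro order_tendstoD[OF LIMSEQ_inverse_real_of_nat]) simp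
          then have "\<forall>\<^sub>F n in sequentially. sgn (b + inverse (real (Suc n)) - x) = 1 - 2 * indicator {b<..} x"
            by eventually_elim (use False in \<open>auto simp: sgn_if\<close>)
          then show ?thesis by (rule tendsto_eventually)
        qed
      qed
      show "(\<lambda>x. sgn (b + inverse (real (Suc n)) - x)) \<in> borel_measurable M" for n
        unfolding measurable_cong_sets[OF M(2) refl] by measurable
      show "(\<lambda>x. 1 - 2 * indicator {b<..} x :: real) \<in> borel_measurable M"
        unfolding measurable_cong_sets[OF M(2) refl] by measurable
    qed (use M in \<open>auto simp: finite_measure.integrable_const sgn_if\<close>)
    have "space M = UNIV" using sets_eq_imp_space_eq[OF M(2)] by simp
    moreover have "integrable M (indicator {b<..} :: real \<Rightarrow> real)"
      using M finite_measure.emeasure_finite[OF M(1)]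
      by (intro integrable_real_indicator) (auto simp: less_top)
    ultimately have "(\<integral>x. 1 - 2 * indicator {b<..} x \<partial>M) = measure M UNIV - 2 * measure M {b<..}"
      using finite_measure.integrable_const[OF M(1)] by (subst Bochner_Integration.integral_diff) auto
    with lim show ?thesis by simp
  qed
  have tail: "measure \<mu> {b<..} = measure \<nu> {b<..}" for b
  proof -
    have "measure \<mu> UNIV - 2 * measure \<mu> {b<..} = measure \<nu> UNIV - 2 * measure \<nu> {b<..}"
    proof (rule LIMSEQ_unique[OF right[OF fin(1) sets(1)]])
      show "(\<lambda>n. \<integral>x. sgn (b + inverse (real (Suc n)) - x) \<partial>\<mu>) \<longlonglongrightarrow> measure \<nu> UNIV - 2 * measure \<nu> {b<..}"
        using right[OF fin(2) sets(2)] by (simp only: full)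
    qed
    then show ?thesis using mass by simp
  qed
  show ?thesis
  proof (rule measure_eqI_lessThan)
    show "emeasure \<mu> {b<..} < \<infinity>" for b
      using finite_measure.emeasure_finite[OF fin(1)] by (simp add: less_top)
    show "emeasure \<mu> {b<..} = emeasure \<nu> {b<..}" for b
      using tail fin by (simp add: finite_measure.emeasure_eq_measure)
  qed (use sets in auto)
qed

section \<open>Polynomials, second kind polynomials and Bessel's inequality\<close>

lemma cpoly_0 [simp]: "cpoly 0 z = 0"
  by (simp add: cpoly_def)

lemma cpoly_pCons [simp]: "cpoly (pCons a p) z = complex_of_real a + z * cpoly p z"
  by (simp add: cpoly_def map_poly_pCons)

lemma cpoly_add [simp]: "cpoly (p + q) z = cpoly p z + cpoly q z"
  by (induction p q rule: poly_induct2) (simp_all add: algebra_simps)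

lemma cpoly_smult [simp]: "cpoly (smult c p) z = complex_of_real c * cpoly p z"
  by (induction p) (simp_all add: algebra_simps)

lemma cpoly_of_real: "cpoly p (complex_of_real x) = complex_of_real (poly p x)"
  by (induction p) simp_all

lemma cnj_cpoly: "cnj (cpoly p z) = cpoly p (cnj z)"
  by (induction p) simp_all

lemma holomorphic_cpoly: "cpoly p holomorphic_on S"
  unfolding cpoly_def[abs_def] by (intro holomorphic_intros)

section \<open>The difference quotient polynomial\<close>

lemma diff_quot_upto:
  assumes "degree p \<le> N"
  shows "diff_quot p z x = (\<Sum>i\<le>N. complex_of_real (coeff p i) *
      (\<Sum>j<i. z ^ j * complex_of_real x ^ (i - 1 - j)))"
  unfolding diff_quot_def using assms
  by (intro sum.mono_neutral_left) (auto simp: coeff_eq_0)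

lemma diff_quot_0 [simp]: "diff_quot 0 z x = 0"
  by (simp add: diff_quot_def)

lemma cpoly_upto:
  assumes "degree p \<le> N"
  shows "cpoly p z = (\<Sum>i\<le>N. complex_of_real (coeff p i) * z ^ i)"
proof -
  have "cpoly p z = (\<Sum>i\<le>degree p. complex_of_real (coeff p i) * z ^ i)"
    by (simp add: cpoly_def poly_altdef degree_map_poly coeff_map_poly)
  also have "\<dots> = (\<Sum>i\<le>N. complex_of_real (coeff p i) * z ^ i)"
    using assms by (intro sum.mono_neutral_left) (auto simp: coeff_eq_0)
  finally show ?thesis .
qed

text \<open>Splitting off the term j = 0 gives a Horner recursion, through which linearity in p and
  \<open>diff_quot_eq\<close> follow by induction on p.\<close>

lemma diff_quot_pCons [simp]:
  "diff_quot (pCons a p) z x = z * diff_quot p z x + complex_of_real (poly p x)"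
proof -
  have step: "(\<Sum>j<Suc i. z ^ j * complex_of_real x ^ (i - j))
      = complex_of_real x ^ i + z * (\<Sum>j<i. z ^ j * complex_of_real x ^ (i - 1 - j))" for i
    by (simp add: sum.lessThan_Suc_shift sum_distrib_left mult.assoc del: sum.lessThan_Suc)
  have "diff_quot (pCons a p) z x = (\<Sum>i\<le>Suc (degree p). complex_of_real (coeff (pCons a p) i) *
      (\<Sum>j<i. z ^ j * complex_of_real x ^ (i - 1 - j)))"
    by (rule diff_quot_upto) (rule degree_pCons_le)
  also have "\<dots> = (\<Sum>i\<le>degree p. complex_of_real (coeff p i) *
      (\<Sum>j<Suc i. z ^ j * complex_of_real x ^ (i - j)))"
    by (subst sum.atMost_Suc_shift) (simp del: sum.lessThan_Suc)
  also have "\<dots> = z * diff_quot p z x + cpoly p (complex_of_real x)"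
    unfolding step diff_quot_def cpoly_upto[OF order.refl]
    by (simp add: algebra_simps sum.distrib sum_distrib_left)
  finally show ?thesis by (simp add: cpoly_of_real)
qed

lemma diff_quot_add [simp]: "diff_quot (p + q) z x = diff_quot p z x + diff_quot q z x"
  by (induction p q rule: poly_induct2) (simp_all add: algebra_simps)

lemma diff_quot_smult [simp]: "diff_quot (smult c p) z x = complex_of_real c * diff_quot p z x"
  by (induction p) (simp_all add: algebra_simps)

lemma diff_quot_eq:
  "(complex_of_real x - z) * diff_quot p z x = complex_of_real (poly p x) - cpoly p z"
proof (induction p)
  case (pCons a p)
  have "(complex_of_real x - z) * diff_quot (pCons a p) z x = z * ((complex_of_real x - z) * diff_quot p z x) + (complex_of_real x - z) * complex_of_real (poly p x)"
    by (simp add: algebra_simps)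
  then show ?case unfolding pCons.IH by (simp add: algebra_simps)
qed simp

section \<open>The moment functional and the polynomials of the second kind\<close>

lemma moment_solutionD:
  assumes "moment_solution t \<mu>"
  shows "finite_measure \<mu>" "sets \<mu> = sets borel" "space \<mu> = UNIV"
    "integrable \<mu> (\<lambda>x. x ^ k)" "(\<integral>x. x ^ k \<partial>\<mu>) = t k"
  using assms sets_eq_imp_space_eq[of \<mu> borel] by (auto simp: moment_solution_def)

lemma integrable_poly:
  assumes "moment_solution t \<mu>"
  shows "integrable \<mu> (poly p)"
  unfolding poly_altdef[abs_def] using assms
  by (intro Bochner_Integration.integrable_sum integrable_mult_right) (simp add: moment_solution_def)

text \<open>The moment functional. By \<open>poly_integral_moments\<close> it depends on the moments
  alone, which makes orthonormality and the second kind polynomials independent of the chosen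
  solution.\<close>

definition poly_integral :: "real measure \<Rightarrow> real poly \<Rightarrow> real" where
  "poly_integral \<mu> p = (\<integral>x. poly p x \<partial>\<mu>)"

lemma poly_integral_moments:
  assumes "moment_solution t \<mu>"
  shows "poly_integral \<mu> p = (\<Sum>i\<le>degree p. coeff p i * t i)"
  unfolding poly_integral_def poly_altdef using moment_solutionD[OF assms]
  by (subst Bochner_Integration.integral_sum) auto

lemma poly_integral_unique:
  assumes "moment_solution t \<mu>" "moment_solution t \<nu>"
  shows "poly_integral \<mu> p = poly_integral \<nu> p"
  using assms by (simp add: poly_integral_moments)

lemma poly_integral_linear:
  assumes "moment_solution t \<mu>"
  shows poly_integral_diff: "poly_integral \<mu> (p - q) = poly_integral \<mu> p - poly_integral \<mu> q"
    and poly_integral_smult: "poly_integral \<mu> (smult c p) = c * poly_integral \<mu> p"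
  using integrable_poly[OF assms] by (simp_all add: poly_integral_def)

lemma poly_integral_sum:
  assumes "moment_solution t \<mu>"
  shows "poly_integral \<mu> (\<Sum>i\<in>A. f i) = (\<Sum>i\<in>A. poly_integral \<mu> (f i))"
  using integrable_poly[OF assms] by (simp add: poly_integral_def poly_sum)

lemma orthonormal_polys_iff:
  "orthonormal_polys \<mu> P \<longleftrightarrow>
     (\<forall>k. degree (P k) = k \<and> lead_coeff (P k) > 0) \<and>
     (\<forall>j k. poly_integral \<mu> (P j * P k) = (if j = k then 1 else 0))"
  by (simp add: orthonormal_polys_def poly_integral_def)

lemma orthonormal_polys_unique_measure:
  assumes "moment_solution t \<mu>" "moment_solution t \<nu>" "orthonormal_polys \<mu> P"
  shows "orthonormal_polys \<nu> P"
  using assms(3) unfolding orthonormal_polys_iff poly_integral_unique[OF assms(1,2)] .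

lemma integrable_of_real_poly:
  assumes "moment_solution t \<mu>"
  shows "integrable \<mu> (\<lambda>x. complex_of_real (poly p x))"
  using integrable_poly[OF assms] by (rule integrable_of_real)

lemma integrable_diff_quot:
  assumes "moment_solution t \<mu>"
  shows "integrable \<mu> (diff_quot p z)"
  by (induction p) (simp_all add: integrable_of_real_poly[OF assms])

lemma second_kind_0 [simp]: "second_kind \<mu> 0 z = 0"
  by (simp add: second_kind_def)

lemma second_kind_linear:
  assumes "moment_solution t \<mu>"
  shows second_kind_pCons: "second_kind \<mu> (pCons a p) z
      = z * second_kind \<mu> p z + complex_of_real (poly_integral \<mu> p)"
    and second_kind_add: "second_kind \<mu> (p + q) z = second_kind \<mu> p z + second_kind \<mu> q z"
    and second_kind_smult: "second_kind \<mu> (smult c p) z = complex_of_real c * second_kind \<mu> p z"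
  using integrable_diff_quot[OF assms] integrable_of_real_poly[OF assms]
  by (simp_all add: second_kind_def poly_integral_def)

text \<open>Needed because \<open>onpQ\<close> integrates against \<open>some_solution t\<close>,
  while Bessel's inequality is applied to other solutions. The recursion in p involves the moment
  functional only.\<close>

lemma second_kind_unique:
  assumes "moment_solution t \<mu>" "moment_solution t \<nu>"
  shows "second_kind \<mu> p z = second_kind \<nu> p z"
  by (induction p)
     (simp_all add: second_kind_pCons[OF assms(1)] second_kind_pCons[OF assms(2)]
        poly_integral_unique[OF assms])

lemma cnj_second_kind:
  assumes "moment_solution t \<mu>"
  shows "cnj (second_kind \<mu> p z) = second_kind \<mu> p (cnj z)"
  by (induction p) (simp_all add: second_kind_pCons[OF assms])

lemma holomorphic_second_kind:
  assumes "moment_solution t \<mu>"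
  shows "second_kind \<mu> p holomorphic_on S"
proof (induction p)
  case 0
  have "second_kind \<mu> 0 = (\<lambda>_. 0)" by auto
  then show ?case by simp
next
  case (pCons a p)
  then show ?case
    by (subst holomorphic_cong[OF refl second_kind_pCons[OF assms]]) (intro holomorphic_intros)
qed

text \<open>By \<open>diff_quot_eq\<close>, p(x)/(x - z) is p(z)/(x - z) plus the difference
  quotient. For an orthonormal p the value is a Fourier coefficient of the Cauchy kernel.\<close>

lemma has_integral_poly_cauchy_kernel:
  assumes sol: "moment_solution t \<mu>" and z: "Im z \<noteq> 0"
  shows "has_bochner_integral \<mu> (\<lambda>x. complex_of_real (poly p x) * (1 / (complex_of_real x - z)))
    (stieltjes \<mu> z * cpoly p z + second_kind \<mu> p z)"
proof -
  have "has_bochner_integral \<mu> (\<lambda>x. 1 / (complex_of_real x - z) * cpoly p z + diff_quot p z x)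
    (stieltjes \<mu> z * cpoly p z + second_kind \<mu> p z)"
    unfolding stieltjes_def second_kind_def
    by (intro has_bochner_integral_add has_bochner_integral_mult_left has_bochner_integral_integrable
        integrable_cauchy_kernel integrable_diff_quot[OF sol] moment_solutionD(1,2)[OF sol] z)
  moreover have "1 / (complex_of_real x - z) * cpoly p z + diff_quot p z x
      = complex_of_real (poly p x) * (1 / (complex_of_real x - z))" for x
    using diff_quot_eq[of x z p] of_real_neq_nonreal[OF z, of x] by (simp add: divide_simps) (simp add: algebra_simps)
  ultimately show ?thesis by simp
qed

lemma integrable_norm_cauchy_kernel_sq:
  assumes "finite_measure \<mu>" "sets \<mu> = sets borel" "Im z \<noteq> 0"
  shows "integrable \<mu> (\<lambda>x. (norm (1 / (complex_of_real x - z)))\<^sup>2)"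
proof (rule finite_measure.integrable_const_bound[OF assms(1)])
  show "AE x in \<mu>. norm ((norm (1 / (complex_of_real x - z)))\<^sup>2) \<le> (1 / \<bar>Im z\<bar>)\<^sup>2"
    using norm_cauchy_kernel_le[OF assms(3)] by (intro AE_I2) (simp only: real_norm_def abs_power2 norm_ge_zero power_mono)
  show "(\<lambda>x. (norm (1 / (complex_of_real x - z)))\<^sup>2) \<in> borel_measurable \<mu>"
    by (intro borel_measurable_power measurable_compose[OF borel_cauchy_kernel[OF assms(2)] borel_measurable_norm])
qed

text \<open>Bessel's inequality for \<open>1 / (x - z)\<close>, whose squared norm is \<open>Im F(z) / Im z\<close>.\<close>

lemma bessel_stieltjes:
  assumes sol: "moment_solution t \<mu>" and on: "orthonormal_polys \<mu> P" and z: "0 < Im z"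
  shows "Im z * (\<Sum>k<n. (norm (stieltjes \<mu> z * cpoly (P k) z + second_kind \<mu> (P k) z))\<^sup>2)
     \<le> Im (stieltjes \<mu> z)"
proof -
  have z': "Im z \<noteq> 0" using z by simp
  note fin = moment_solutionD(1,2)[OF sol]
  define k where "k x = 1 / (complex_of_real x - z)" for x
  define y where "y i = stieltjes \<mu> z * cpoly (P i) z + second_kind \<mu> (P i) z" for i
  define K where "K = (\<integral>x. (norm (k x))\<^sup>2 \<partial>\<mu>)"
  define g where "g x = k x - (\<Sum>i<n. y i * complex_of_real (poly (P i) x))" for x
  have I1: "has_bochner_integral \<mu> (\<lambda>x. complex_of_real (poly (P i) x) * k x) (y i)" for i
    unfolding k_def y_def by (rule has_integral_poly_cauchy_kernel[OF sol z'])
  have I2: "has_bochner_integral \<mu> (\<lambda>x. complex_of_real (poly (P i) x) * cnj (k x)) (cnj (y i))" for i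
    using has_bochner_integral_bounded_linear[OF bounded_linear_cnj I1[of i]] by simp
  have I3: "has_bochner_integral \<mu> (\<lambda>x. complex_of_real (poly (P i) x * poly (P j) x))
      (complex_of_real (if i = j then 1 else 0))" for i j
  proof -
    have "integrable \<mu> (\<lambda>x. poly (P i) x * poly (P j) x)"
      using integrable_poly[OF sol, of "P i * P j"] by (simp add: poly_mult[abs_def])
    moreover have "(\<integral>x. poly (P i) x * poly (P j) x \<partial>\<mu>) = (if i = j then 1 else 0)"
      using on by (simp add: orthonormal_polys_def)
    ultimately show ?thesis
      by (intro has_bochner_integral_of_real) (simp add: has_bochner_integral_iff)
  qed
  have I4: "has_bochner_integral \<mu> (\<lambda>x. complex_of_real ((norm (k x))\<^sup>2)) (complex_of_real K)"
    using integrable_norm_cauchy_kernel_sq[OF fin z']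
    unfolding K_def k_def by (intro has_bochner_integral_of_real has_bochner_integral_integrable)
  \<comment> \<open>Expansion of |k - sum y_i P_i|^2; the P_i are real on the real line, so only k
    and the coefficients get conjugated.\<close>
  have gg: "complex_of_real ((norm (g x))\<^sup>2) = complex_of_real ((norm (k x))\<^sup>2)
      - (\<Sum>i<n. cnj (y i) * (complex_of_real (poly (P i) x) * k x))
      - (\<Sum>i<n. y i * (complex_of_real (poly (P i) x) * cnj (k x)))
      + (\<Sum>i<n. \<Sum>j<n. y j * cnj (y i) * complex_of_real (poly (P i) x * poly (P j) x))" for x
    unfolding complex_norm_square g_def
    by (simp add: algebra_simps sum_distrib_left sum_distrib_right sum_product)
  have "has_bochner_integral \<mu> (\<lambda>x. complex_of_real ((norm (g x))\<^sup>2))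
     (complex_of_real K - (\<Sum>i<n. cnj (y i) * y i) - (\<Sum>i<n. y i * cnj (y i))
      + (\<Sum>i<n. \<Sum>j<n. y j * cnj (y i) * complex_of_real (if i = j then 1 else 0)))"
    unfolding gg
    by (intro has_bochner_integral_add has_bochner_integral_diff has_bochner_integral_sum
        has_bochner_integral_mult_right I1 I2 I3 I4)
  \<comment> \<open>By orthonormality the double sum is the sum of |y_i|^2 and cancels one of the
    two cross terms.\<close>
  also have "complex_of_real K - (\<Sum>i<n. cnj (y i) * y i) - (\<Sum>i<n. y i * cnj (y i))
      + (\<Sum>i<n. \<Sum>j<n. y j * cnj (y i) * complex_of_real (if i = j then 1 else 0))
      = complex_of_real (K - (\<Sum>i<n. (norm (y i))\<^sup>2))"
    by (simp add: complex_norm_square[simplified of_real_power] if_distrib[of complex_of_real] if_distrib[of "\<lambda>c. _ * c"] sum.delta mult.commute cong: if_cong)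
  finally have "has_bochner_integral \<mu> (\<lambda>x. (norm (g x))\<^sup>2) (K - (\<Sum>i<n. (norm (y i))\<^sup>2))"
    using has_bochner_integral_bounded_linear[OF bounded_linear_Re] by fastforce
  then have "K - (\<Sum>i<n. (norm (y i))\<^sup>2) \<ge> 0"
    by (metis Bochner_Integration.integral_nonneg has_bochner_integral_iff zero_le_power2)
  moreover have "Im (stieltjes \<mu> z) = Im z * K"
    unfolding K_def k_def by (rule Im_stieltjes[OF fin z'])
  ultimately show ?thesis using z unfolding y_def by (simp add: mult_left_mono)
qed

section \<open>Orthonormal polynomials of an indeterminate problem\<close>

text \<open>All solutions have total mass \<open>t 0\<close>, so \<open>stieltjes_inj\<close>
  separates distinct ones by their transforms.\<close>

lemma indeterminate_stieltjes_neq: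
  assumes "indeterminate t"
  obtains \<mu> \<nu> z where "moment_solution t \<mu>" "moment_solution t \<nu>" "0 < Im z"
    "stieltjes \<mu> z \<noteq> stieltjes \<nu> z"
proof -
  obtain \<mu> \<nu> where sol: "moment_solution t \<mu>" "moment_solution t \<nu>" and ne: "\<mu> \<noteq> \<nu>"
    using assms by (auto simp: indeterminate_def)
  have mass: "measure M UNIV = t 0" if "moment_solution t M" for M
    using moment_solutionD(3)[OF that] moment_solutionD(5)[OF that, of 0] by simp
  have "\<exists>z. 0 < Im z \<and> stieltjes \<mu> z \<noteq> stieltjes \<nu> z"
    using stieltjes_inj[of \<mu> \<nu>] ne mass moment_solutionD(1,2)[OF sol(1)] moment_solutionD(1,2)[OF sol(2)] sol
    by metis
  then show ?thesis using sol that by blast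
qed

text \<open>If \<open>p\<close> vanishes \<open>\<mu>\<close>- and \<open>\<nu>\<close>-almost everywhere, then \<open>p(z) (F\<^sub>\<mu>(z) - F\<^sub>\<nu>(z)) = 0\<close> for all
  non-real \<open>z\<close>, so \<open>p\<close> vanishes on a nonempty open set.\<close>

lemma indeterminate_poly_integral_pos:
  assumes ind: "indeterminate t" and sol: "moment_solution t \<rho>" and p: "p \<noteq> 0"
  shows "0 < poly_integral \<rho> (p * p)"
proof (rule ccontr)
  assume neg: "\<not> ?thesis"
  obtain \<mu> \<nu> w where mn: "moment_solution t \<mu>" "moment_solution t \<nu>" and w: "0 < Im w"
    "stieltjes \<mu> w \<noteq> stieltjes \<nu> w"
    using indeterminate_stieltjes_neq[OF ind] by blast
  define S where "S = {z. 0 < Im z} \<inter> (\<lambda>z. stieltjes \<mu> z - stieltjes \<nu> z) -` (- {0})"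
  \<comment> \<open>p * p has the same integral under every solution, so \<open>neg\<close> forces p
    = 0 almost everywhere for each M, and p(x)/(x - z) integrates to 0.\<close>
  have zero: "stieltjes M z * cpoly p z + second_kind M p z = 0"
    if M: "moment_solution t M" and z: "0 < Im z" for M z
  proof -
    have "poly_integral M (p * p) \<le> 0"
      using neg poly_integral_unique[OF M sol] by simp
    moreover have "poly_integral M (p * p) \<ge> 0"
      by (simp add: poly_integral_def)
    ultimately have "(\<integral>x. poly (p * p) x \<partial>M) = 0" unfolding poly_integral_def by linarith
    then have "AE x in M. poly (p * p) x = 0"
      by (subst (asm) integral_nonneg_eq_0_iff_AE[OF integrable_poly[OF M, of "p * p"]]) simp_all
    then have "AE x in M. complex_of_real (poly p x) * (1 / (complex_of_real x - z)) = 0"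
      by eventually_elim simp
    then have "(\<integral>x. complex_of_real (poly p x) * (1 / (complex_of_real x - z)) \<partial>M) = 0"
      by (rule integral_eq_zero_AE)
    then show ?thesis
      using has_integral_poly_cauchy_kernel[OF M, of z p] z
      by (simp add: has_bochner_integral_iff)
  qed
  have "open S"
    unfolding S_def
    by (intro continuous_open_preimage continuous_intros holomorphic_on_imp_continuous_on
        holomorphic_stieltjes moment_solutionD(1,2)[OF mn(1)] moment_solutionD(1,2)[OF mn(2)])
       (auto intro: open_halfspace_Im_gt)
  moreover have "w \<in> S" using w by (simp add: S_def)
  ultimately have "infinite S" using finite_imp_not_open by blast
  moreover have "S \<subseteq> {z. poly (map_poly complex_of_real p) z = 0}"
  proof
    fix z assume "z \<in> S"
    then have z: "0 < Im z" "stieltjes \<mu> z \<noteq> stieltjes \<nu> z" by (auto simp: S_def)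
    \<comment> \<open>The second kind terms depend on the moments only and cancel in the
      difference.\<close>
    have "(stieltjes \<mu> z - stieltjes \<nu> z) * cpoly p z
        = (stieltjes \<mu> z * cpoly p z + second_kind \<mu> p z)
          - (stieltjes \<nu> z * cpoly p z + second_kind \<nu> p z)"
      by (simp add: second_kind_unique[OF mn, of p z] algebra_simps)
    also have "\<dots> = 0" using zero[OF mn(1) z(1)] zero[OF mn(2) z(1)] by simp
    finally have "(stieltjes \<mu> z - stieltjes \<nu> z) * cpoly p z = 0" .
    then show "z \<in> {z. poly (map_poly complex_of_real p) z = 0}"
      using z by (simp add: cpoly_def)
  qed
  moreover have "map_poly complex_of_real p \<noteq> 0"
    using p by (subst map_poly_eq_0_iff) auto
  ultimately show False
    using poly_roots_finite finite_subset by blast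
qed

text \<open>Below, ``\<open>coeff p i = 0\<close> for all \<open>i \<ge> n\<close>'' says that \<open>p\<close> is a polynomial of degree less
  than \<open>n\<close>, including \<open>p = 0\<close> for \<open>n = 0\<close>.\<close>

lemma orthonormal_polys_expansion:
  assumes sol: "moment_solution t \<mu>" and on: "orthonormal_polys \<mu> P"
    and p: "\<And>i. n \<le> i \<Longrightarrow> coeff p i = 0"
  shows "p = (\<Sum>j<n. smult (poly_integral \<mu> (p * P j)) (P j))"
proof -
  have deg: "degree (P k) = k" "coeff (P k) k > 0" for k
    using on by (auto simp: orthonormal_polys_def) metis
  have "\<exists>c. p = (\<Sum>j<n. smult (c j) (P j))" using p
  proof (induction n arbitrary: p)
    case 0
    then show ?case by (simp add: poly_eq_iff)
  next
    case (Suc n)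
    define q where "q = p - smult (coeff p n / coeff (P n) n) (P n)"
    have "coeff q i = 0" if "n \<le> i" for i
    proof (cases "i = n")
      case True
      then show ?thesis using deg(2)[of n] by (simp add: q_def)
    next
      case False
      then have "Suc n \<le> i" using that by simp
      then show ?thesis using Suc.prems deg(1)[of n] by (simp add: q_def coeff_eq_0)
    qed
    then obtain c where c: "q = (\<Sum>j<n. smult (c j) (P j))" using Suc.IH by blast
    have "p = (\<Sum>j<Suc n. smult ((c(n := coeff p n / coeff (P n) n)) j) (P j))"
      using c by (simp add: q_def algebra_simps)
    then show ?case by blast
  qed
  then obtain c where c: "p = (\<Sum>j<n. smult (c j) (P j))" by blast
  have "poly_integral \<mu> (p * P j) = c j" if "j < n" for j
  proof -
    have "poly_integral \<mu> (p * P j) = (\<Sum>i<n. c i * poly_integral \<mu> (P i * P j))"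
      by (subst c) (simp add: sum_distrib_right poly_integral_sum[OF sol] poly_integral_smult[OF sol])
    also have "\<dots> = c j"
      using on that by (simp add: orthonormal_polys_iff if_distrib[of "\<lambda>x. _ * x"] sum.delta cong: if_cong)
    finally show ?thesis .
  qed
  then show ?thesis by (subst c) simp
qed

lemma orthonormal_polys_orthogonal:
  assumes sol: "moment_solution t \<mu>" and on: "orthonormal_polys \<mu> P"
    and p: "\<And>i. n \<le> i \<Longrightarrow> coeff p i = 0"
  shows "poly_integral \<mu> (p * P n) = 0"
proof -
  have "poly_integral \<mu> (p * P n)
      = (\<Sum>j<n. poly_integral \<mu> (p * P j) * poly_integral \<mu> (P j * P n))"
    by (subst orthonormal_polys_expansion[OF sol on p])
       (simp_all add: sum_distrib_right poly_integral_sum[OF sol] poly_integral_smult[OF sol])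
  also have "\<dots> = 0"
    using on by (intro sum.neutral) (simp add: orthonormal_polys_iff)
  finally show ?thesis .
qed

text \<open>With c matching the leading coefficients, r = \<open>P n - smult c (P' n)\<close> has
  degree below n, so it is orthogonal to \<open>P n\<close> and \<open>P' n\<close>, hence to
  itself. Then r = 0, the norms give c^2 = 1, and the signs of the leading coefficients give c =
  1.\<close>

lemma orthonormal_polys_unique:
  assumes sol: "moment_solution t \<mu>"
    and pd: "\<And>p. p \<noteq> 0 \<Longrightarrow> 0 < poly_integral \<mu> (p * p)"
    and on: "orthonormal_polys \<mu> P" "orthonormal_polys \<mu> P'"
  shows "P = P'"
proof
  fix n
  have deg: "degree (P n) = n" "coeff (P n) n > 0" "degree (P' n) = n" "coeff (P' n) n > 0"
    using on by (auto simp: orthonormal_polys_def) metis+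
  define c where "c = coeff (P n) n / coeff (P' n) n"
  define r where "r = P n - smult c (P' n)"
  have cpos: "c > 0" using deg by (simp add: c_def)
  have r: "coeff r i = 0" if "n \<le> i" for i
    using that deg by (cases "i = n") (auto simp: r_def c_def coeff_eq_0)
  have "r * r = r * P n - smult c (r * P' n)"
    by (simp add: r_def algebra_simps smult_diff_right)
  then have "poly_integral \<mu> (r * r) = poly_integral \<mu> (r * P n) - c * poly_integral \<mu> (r * P' n)"
    by (simp only: poly_integral_diff[OF sol] poly_integral_smult[OF sol])
  then have "poly_integral \<mu> (r * r) = 0"
    using orthonormal_polys_orthogonal[OF sol on(1) r] orthonormal_polys_orthogonal[OF sol on(2) r] by simp
  then have "r = 0" using pd[of r] by fastforce
  then have eq: "P n = smult c (P' n)" by (simp add: r_def)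
  have "1 = poly_integral \<mu> (P n * P n)" using on(1) by (simp add: orthonormal_polys_iff)
  also have "\<dots> = c * (c * poly_integral \<mu> (P' n * P' n))"
    by (simp add: eq poly_integral_smult[OF sol])
  also have "poly_integral \<mu> (P' n * P' n) = 1" using on(2) by (simp add: orthonormal_polys_iff)
  finally have "c\<^sup>2 = 1" by (simp add: power2_eq_square)
  then have "c = 1" using cpos by (simp add: power2_eq_1_iff)
  then show "P n = P' n" using eq by simp
qed

section \<open>Existence of the orthonormal polynomials\<close>

fun gram_schmidt :: "real measure \<Rightarrow> nat \<Rightarrow> real poly" where
  "gram_schmidt \<mu> n = (let r = monom 1 n
      - (\<Sum>j<n. smult (poly_integral \<mu> (monom 1 n * gram_schmidt \<mu> j)) (gram_schmidt \<mu> j))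
    in smult (1 / sqrt (poly_integral \<mu> (r * r))) r)"

declare gram_schmidt.simps [simp del]

lemma orthonormal_polys_gram_schmidt:
  assumes sol: "moment_solution t \<mu>"
    and pd: "\<And>p. p \<noteq> 0 \<Longrightarrow> 0 < poly_integral \<mu> (p * p)"
  shows "orthonormal_polys \<mu> (gram_schmidt \<mu>)"
proof -
  let ?g = "gram_schmidt \<mu>" and ?L = "poly_integral \<mu>"
  \<comment> \<open>The induction yields orthogonality to lower indices only; symmetry of the
    product extends it to all pairs.\<close>
  have sym: "?L (?g i * ?g j) = (if i = j then 1 else 0)"
    if "?L (?g i * ?g i) = 1 \<and> (\<forall>k<i. ?L (?g i * ?g k) = 0)"
      "?L (?g j * ?g j) = 1 \<and> (\<forall>k<j. ?L (?g j * ?g k) = 0)" for i j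
  proof (cases i j rule: linorder_cases)
    case less
    then have "?L (?g j * ?g i) = 0" using that by simp
    then show ?thesis using less by (simp add: mult.commute)
  qed (use that in auto)
  have main: "degree (?g n) = n \<and> coeff (?g n) n > 0 \<and> ?L (?g n * ?g n) = 1 \<and> (\<forall>j<n. ?L (?g n * ?g j) = 0)" for n
  proof (induction n rule: less_induct)
    case (less n)
    define r where "r = monom 1 n - (\<Sum>j<n. smult (?L (monom 1 n * ?g j)) (?g j))"
    define N where "N = ?L (r * r)"
    have g: "?g n = smult (1 / sqrt N) r"
      by (subst gram_schmidt.simps) (simp add: r_def N_def Let_def)
    \<comment> \<open>The subtracted polynomials have degree below n, so r stays monic of degree n;
      being nonzero it can be normalized.\<close>
    have cr: "coeff r i = coeff (monom 1 n :: real poly) i" if "n \<le> i" for i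
    proof -
      have "coeff (\<Sum>j<n. smult (?L (monom 1 n * ?g j)) (?g j)) i = 0"
        unfolding coeff_sum using less.IH that by (intro sum.neutral) (auto simp: coeff_eq_0)
      then show ?thesis by (simp add: r_def)
    qed
    then have rn: "coeff r n = 1" by simp
    have "degree r \<le> n" using cr by (intro degree_le) simp
    with rn have degr: "degree r = n" using le_degree[of r n] by simp
    have "r \<noteq> 0" using rn by auto
    then have N: "N > 0" unfolding N_def by (rule pd)
    have orth: "?L (r * ?g j) = 0" if "j < n" for j
    proof -
      have "?L (r * ?g j) = ?L (monom 1 n * ?g j) - (\<Sum>i<n. ?L (monom 1 n * ?g i) * ?L (?g i * ?g j))"
        by (simp add: r_def algebra_simps sum_distrib_left poly_integral_diff[OF sol] poly_integral_sum[OF sol]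
            poly_integral_smult[OF sol])
      also have "(\<Sum>i<n. ?L (monom 1 n * ?g i) * ?L (?g i * ?g j))
          = (\<Sum>i<n. if i = j then ?L (monom 1 n * ?g j) else 0)"
      proof (rule sum.cong[OF refl])
        fix i assume "i \<in> {..<n}"
        then have "?L (?g i * ?g j) = (if i = j then 1 else 0)"
          using sym[of i j] less.IH[of i] less.IH[OF that] by blast
        then show "?L (monom 1 n * ?g i) * ?L (?g i * ?g j)
            = (if i = j then ?L (monom 1 n * ?g j) else 0)" by simp
      qed
      finally show ?thesis using that by (simp add: sum.delta)
    qed
    have "?L (?g n * ?g n) = 1 / sqrt N * (1 / sqrt N) * N"
      by (simp add: g N_def poly_integral_smult[OF sol])
    also have "\<dots> = 1" using N by (simp add: field_simps)
    finally show ?case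
      using N rn degr orth by (simp add: g poly_integral_smult[OF sol])
  qed
  have "?L (?g j * ?g k) = (if j = k then 1 else 0)" for j k
    using sym[of j k] main[of j] main[of k] by blast
  then show ?thesis using main by (simp add: orthonormal_polys_iff)
qed

lemma moment_solution_some_solution:
  assumes "indeterminate t"
  shows "moment_solution t (some_solution t)"
  unfolding some_solution_def using assms by (auto simp: indeterminate_def intro: someI)

text \<open>Existence and uniqueness give meaning to the \<open>THE\<close> in \<open>onp\<close>.
  Orthonormality involves the moments only, so it transfers from \<open>some_solution t\<close> to
  every \<mu>.\<close>

lemma orthonormal_polys_onp:
  assumes ind: "indeterminate t" and sol: "moment_solution t \<mu>"
  shows "orthonormal_polys \<mu> (onp t)"
proof -
  let ?\<rho> = "some_solution t"
  note rho = moment_solution_some_solution[OF ind]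
  have "\<exists>!P. orthonormal_polys ?\<rho> P"
    using orthonormal_polys_gram_schmidt[OF rho] orthonormal_polys_unique[OF rho]
      indeterminate_poly_integral_pos[OF ind rho] by blast
  then have "orthonormal_polys ?\<rho> (onp t)" unfolding onp_def by (rule theI')
  then show ?thesis using orthonormal_polys_unique_measure[OF rho sol] by blast
qed

text \<open>Multiplication by x is symmetric for the moment functional: the coefficient of x P_k at
  P_j is that of x P_j at P_k, which is 0 for j + 1 < k and \<open>b (k - 1)\<close> for j = k -
  1.\<close>

lemma orthonormal_polys_recurrence:
  assumes sol: "moment_solution t \<mu>" and on: "orthonormal_polys \<mu> P"
  shows "\<exists>a b. \<forall>k. pCons 0 (P k) = smult (b k) (P (Suc k)) + smult (a k) (P k)
      + (if k = 0 then 0 else smult (b (k - 1)) (P (k - 1)))"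
proof -
  define a where "a k = poly_integral \<mu> (pCons 0 (P k) * P k)" for k
  define b where "b k = poly_integral \<mu> (pCons 0 (P k) * P (Suc k))" for k
  have deg: "degree (P k) = k" for k using on by (auto simp: orthonormal_polys_def)
  have co: "coeff (pCons 0 (P k)) i = 0" if "Suc (Suc k) \<le> i" for i k
    using that deg[of k] by (cases i) (auto simp: coeff_eq_0)
  have swap: "pCons 0 p * q = pCons 0 q * p" for p q :: "real poly"
    by (simp add: mult.commute)
  have "pCons 0 (P k) = smult (b k) (P (Suc k)) + smult (a k) (P k)
      + (if k = 0 then 0 else smult (b (k - 1)) (P (k - 1)))" for k
  proof -
    have "pCons 0 (P k) = (\<Sum>j<Suc (Suc k). smult (poly_integral \<mu> (pCons 0 (P k) * P j)) (P j))"
      by (rule orthonormal_polys_expansion[OF sol on co])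
    also have "\<dots> = smult (b k) (P (Suc k)) + smult (a k) (P k)
        + (\<Sum>j<k. smult (poly_integral \<mu> (pCons 0 (P k) * P j)) (P j))"
      by (simp add: a_def b_def)
    also have "(\<Sum>j<k. smult (poly_integral \<mu> (pCons 0 (P k) * P j)) (P j))
        = (if k = 0 then 0 else smult (b (k - 1)) (P (k - 1)))"
    proof (cases k)
      case (Suc m)
      have "poly_integral \<mu> (pCons 0 (P k) * P j) = 0" if "j < m" for j
        unfolding swap[of "P k"] using that Suc by (intro orthonormal_polys_orthogonal[OF sol on] co) simp
      then show ?thesis using Suc by (simp add: b_def mult.commute)
    qed simp
    finally show ?thesis .
  qed
  then show ?thesis by blast
qed

section \<open>Jacobi recurrences\<close>

text \<open>Solutions of the three-term recurrence, with an inhomogeneity \<open>\<alpha>\<close> in the first equation: it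
  vanishes for the orthonormal polynomials but not for those of the second kind.\<close>

definition jacobi_seq ::
  "(nat \<Rightarrow> real) \<Rightarrow> (nat \<Rightarrow> real) \<Rightarrow> complex \<Rightarrow> complex \<Rightarrow> (nat \<Rightarrow> complex) \<Rightarrow> bool" where
  "jacobi_seq a b z \<alpha> y \<longleftrightarrow> (\<forall>k. z * y k + (if k = 0 then \<alpha> else 0)
     = complex_of_real (b k) * y (Suc k) + complex_of_real (a k) * y k
       + (if k = 0 then 0 else complex_of_real (b (k - 1)) * y (k - 1)))"

text \<open>Discrete Green (Christoffel-Darboux) identity: in the Casoratian of two solutions the
  \<open>a\<close> terms cancel and the \<open>b\<close> terms telescope, while the inhomogeneities
  survive as a boundary term. It is bilinear; conjugates enter through
  \<open>jacobi_seq_cnj\<close>.\<close>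

lemma jacobi_seq_green:
  assumes y: "jacobi_seq a b z \<alpha> y" and v: "jacobi_seq a b z' \<beta> v"
  shows "complex_of_real (b n) * (y (Suc n) * v n - y n * v (Suc n))
     = (z - z') * (\<Sum>k\<le>n. y k * v k) + (\<alpha> * v 0 - \<beta> * y 0)"
proof (induction n)
  case 0
  have e: "complex_of_real (b 0) * y 1 = z * y 0 + \<alpha> - complex_of_real (a 0) * y 0"
    "complex_of_real (b 0) * v 1 = z' * v 0 + \<beta> - complex_of_real (a 0) * v 0"
    using y v by (auto simp: jacobi_seq_def dest!: spec[of _ 0])
  have "complex_of_real (b 0) * (y (Suc 0) * v 0 - y 0 * v (Suc 0))
      = (complex_of_real (b 0) * y 1) * v 0 - y 0 * (complex_of_real (b 0) * v 1)"
    by (simp add: algebra_simps)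
  then show ?case unfolding e by (simp add: algebra_simps)
next
  case (Suc n)
  let ?m = "Suc n"
  have e: "complex_of_real (b ?m) * y (Suc ?m)
      = z * y ?m - complex_of_real (a ?m) * y ?m - complex_of_real (b n) * y n"
    "complex_of_real (b ?m) * v (Suc ?m)
      = z' * v ?m - complex_of_real (a ?m) * v ?m - complex_of_real (b n) * v n"
    using y v by (auto simp: jacobi_seq_def algebra_simps dest!: spec[of _ ?m])
  have "complex_of_real (b ?m) * (y (Suc ?m) * v ?m - y ?m * v (Suc ?m))
      = (complex_of_real (b ?m) * y (Suc ?m)) * v ?m - y ?m * (complex_of_real (b ?m) * v (Suc ?m))"
    by (simp add: algebra_simps)
  then have "complex_of_real (b ?m) * (y (Suc ?m) * v ?m - y ?m * v (Suc ?m))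
      = (z - z') * (y ?m * v ?m) + complex_of_real (b n) * (y (Suc n) * v n - y n * v (Suc n))"
    unfolding e by (simp add: algebra_simps)
  then show ?case unfolding Suc.IH by (simp add: algebra_simps)
qed

text \<open>Serves to treat F P_k + Q_k as a single solution of the recurrence.\<close>

lemma jacobi_seq_add_scaled:
  assumes "jacobi_seq a b z \<alpha> y" "jacobi_seq a b z \<beta> v"
  shows "jacobi_seq a b z (w * \<alpha> + \<beta>) (\<lambda>k. w * y k + v k)"
  unfolding jacobi_seq_def
proof
  fix k
  have e: "z * y k + (if k = 0 then \<alpha> else 0)
     = complex_of_real (b k) * y (Suc k) + complex_of_real (a k) * y k
       + (if k = 0 then 0 else complex_of_real (b (k - 1)) * y (k - 1))"
    "z * v k + (if k = 0 then \<beta> else 0)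
     = complex_of_real (b k) * v (Suc k) + complex_of_real (a k) * v k
       + (if k = 0 then 0 else complex_of_real (b (k - 1)) * v (k - 1))"
    using assms by (auto simp: jacobi_seq_def)
  have "z * (w * y k + v k) + (if k = 0 then w * \<alpha> + \<beta> else 0)
    = w * (z * y k + (if k = 0 then \<alpha> else 0)) + (z * v k + (if k = 0 then \<beta> else 0))"
    by (simp add: algebra_simps)
  then show "z * (w * y k + v k) + (if k = 0 then w * \<alpha> + \<beta> else 0)
    = complex_of_real (b k) * (w * y (Suc k) + v (Suc k)) + complex_of_real (a k) * (w * y k + v k)
     + (if k = 0 then 0 else complex_of_real (b (k - 1)) * (w * y (k - 1) + v (k - 1)))"
    unfolding e by (simp add: algebra_simps)
qed

text \<open>The coefficients are real. Green's identity for a solution and its conjugate produces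
  sums of squared norms.\<close>

lemma jacobi_seq_cnj:
  assumes "jacobi_seq a b z \<alpha> y"
  shows "jacobi_seq a b (cnj z) (cnj \<alpha>) (\<lambda>k. cnj (y k))"
  unfolding jacobi_seq_def
proof
  fix k
  have "cnj (z * y k + (if k = 0 then \<alpha> else 0))
     = cnj (complex_of_real (b k) * y (Suc k) + complex_of_real (a k) * y k
       + (if k = 0 then 0 else complex_of_real (b (k - 1)) * y (k - 1)))"
    using assms by (auto simp: jacobi_seq_def)
  then show "cnj z * cnj (y k) + (if k = 0 then cnj \<alpha> else 0)
     = complex_of_real (b k) * cnj (y (Suc k)) + complex_of_real (a k) * cnj (y k)
       + (if k = 0 then 0 else complex_of_real (b (k - 1)) * cnj (y (k - 1)))"
    by (auto split: if_splits)
qed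

text \<open>Variation of constants: passing from the spectral parameter \<open>z\<^sub>0\<close> to \<open>z\<close>.\<close>

lemma jacobi_seq_perturbation:
  assumes p: "jacobi_seq a b z0 0 p" and q: "jacobi_seq a b z0 \<gamma> q"
    and init: "p 0 * \<gamma> = 1" "q 0 = 0" and u: "jacobi_seq a b z \<alpha> u"
  shows "u n = (z - z0) * (\<Sum>k<n. (p k * q n - p n * q k) * u k) + \<alpha> * p 0 * q n + \<gamma> * u 0 * p n"
proof -
  let ?b = "complex_of_real (b n)"
  \<comment> \<open>\<open>X\<close> and \<open>Y\<close> evaluate the Casoratians of u with p and
    q, and \<open>W\<close> that of p with q. The latter is the nonzero constant -1, so u is
    recovered by Cramer's rule.\<close>
  have X: "?b * (u (Suc n) * p n - u n * p (Suc n)) = (z - z0) * (\<Sum>k\<le>n. u k * p k) + \<alpha> * p 0"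
    using jacobi_seq_green[OF u p, of n] by simp
  have Y: "?b * (u (Suc n) * q n - u n * q (Suc n)) = (z - z0) * (\<Sum>k\<le>n. u k * q k) - \<gamma> * u 0"
    using jacobi_seq_green[OF u q, of n] init by simp
  have W: "?b * (p (Suc n) * q n - p n * q (Suc n)) = - 1"
    using jacobi_seq_green[OF p q, of n] init by (simp add: mult.commute)
  have "u n = - u n * (?b * (p (Suc n) * q n - p n * q (Suc n)))" unfolding W by simp
  also have "\<dots> = q n * (?b * (u (Suc n) * p n - u n * p (Suc n)))
      - p n * (?b * (u (Suc n) * q n - u n * q (Suc n)))"
    by (simp add: algebra_simps)
  also have "\<dots> = (z - z0) * (q n * (\<Sum>k\<le>n. u k * p k) - p n * (\<Sum>k\<le>n. u k * q k))
      + \<alpha> * p 0 * q n + \<gamma> * u 0 * p n"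
    unfolding X Y by (simp add: algebra_simps)
  also have "q n * (\<Sum>k\<le>n. u k * p k) - p n * (\<Sum>k\<le>n. u k * q k)
      = (\<Sum>k\<le>n. (p k * q n - p n * q k) * u k)"
    by (simp add: sum_distrib_left sum_subtractf[symmetric] algebra_simps)
  \<comment> \<open>The term k = n vanishes, so \<open>u n\<close> is expressed by earlier values
    and the initial data.\<close>
  also have "\<dots> = (\<Sum>k<n. (p k * q n - p n * q k) * u k)"
    by (simp add: lessThan_Suc_atMost[symmetric])
  finally show ?thesis .
qed

section \<open>Square-summability bounds and series with entire sum\<close>

lemma discrete_gronwall_l2:
  fixes u h :: "nat \<Rightarrow> real"
  assumes h: "\<And>n. 0 \<le> h n" and u: "\<And>n. 0 \<le> u n" and X: "0 \<le> X" and R: "0 \<le> R"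
    and M: "\<And>n. (\<Sum>k<n. (h k)\<^sup>2) \<le> M"
    and bd: "\<And>n. u n \<le> h n * (X + R * (\<Sum>k<n. h k * u k))"
  shows "(\<Sum>k<n. (u k)\<^sup>2) \<le> exp (2 * (X\<^sup>2 + R\<^sup>2 * M) * M)"
proof -
  define c where "c = 2 * (X\<^sup>2 + R\<^sup>2 * M)"
  have M0: "0 \<le> M" using M[of 0] by simp
  then have c0: "0 \<le> c" by (simp add: c_def)
  \<comment> \<open>For the partial sums S of the squares, Cauchy-Schwarz turns \<open>bd\<close>
    into S(n+1) + 1 <= (S(n) + 1)(1 + c h_n^2). The added 1 absorbs the term with X, and 1 + x <=
    exp x closes the induction.\<close>
  have "(\<Sum>k<n. (u k)\<^sup>2) + 1 \<le> exp (c * (\<Sum>k<n. (h k)\<^sup>2))"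
  proof (induction n)
    case (Suc n)
    let ?S = "\<Sum>k<n. (u k)\<^sup>2" and ?T = "\<Sum>k<n. h k * u k"
    have T: "?T\<^sup>2 \<le> M * ?S"
    proof -
      have "?T\<^sup>2 \<le> (\<Sum>k<n. (h k)\<^sup>2) * ?S" by (rule Cauchy_Schwarz_ineq_sum)
      also have "\<dots> \<le> M * ?S" by (intro mult_right_mono M sum_nonneg) simp
      finally show ?thesis .
    qed
    have S0: "0 \<le> ?S" by (intro sum_nonneg) simp
    have T0: "0 \<le> ?T" using h u by (intro sum_nonneg) simp
    have "(u n)\<^sup>2 \<le> (h n * (X + R * ?T))\<^sup>2" by (intro power_mono bd u)
    also have "\<dots> = (h n)\<^sup>2 * (X + R * ?T)\<^sup>2" by (simp add: power_mult_distrib)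
    also have "\<dots> \<le> (h n)\<^sup>2 * (2 * X\<^sup>2 + 2 * (R\<^sup>2 * ?T\<^sup>2))"
    proof (intro mult_left_mono)
      show "(X + R * ?T)\<^sup>2 \<le> 2 * X\<^sup>2 + 2 * (R\<^sup>2 * ?T\<^sup>2)"
        using zero_le_power2[of "X - R * ?T"] by (simp add: power2_eq_square algebra_simps)
    qed simp
    also have "\<dots> \<le> (h n)\<^sup>2 * (2 * X\<^sup>2 + 2 * (R\<^sup>2 * (M * ?S)))"
      by (intro mult_left_mono add_left_mono T) auto
    also have "\<dots> \<le> (h n)\<^sup>2 * (c * (?S + 1))"
      unfolding c_def using S0 M0 by (intro mult_left_mono) (auto simp: algebra_simps)
    finally have "?S + (u n)\<^sup>2 + 1 \<le> (?S + 1) * (1 + c * (h n)\<^sup>2)" by (simp add: algebra_simps)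
    also have "\<dots> \<le> exp (c * (\<Sum>k<n. (h k)\<^sup>2)) * exp (c * (h n)\<^sup>2)"
      using S0 c0 by (intro mult_mono Suc.IH exp_ge_add_one_self) auto
    also have "\<dots> = exp (c * (\<Sum>k<Suc n. (h k)\<^sup>2))"
      by (simp add: exp_add[symmetric] algebra_simps)
    finally show ?case by simp
  qed simp
  also have "\<dots> \<le> exp (c * M)" using M c0 by (simp add: mult_left_mono)
  finally show ?thesis by (simp add: c_def)
qed

text \<open>With h = |p| + |q| the kernel satisfies |p_k q_n - p_n q_k| <= h_k h_n, so
  \<open>jacobi_seq_perturbation\<close> supplies the Gronwall hypothesis. The bound depends on u, z
  and \<alpha> only through R and X.\<close>

lemma jacobi_seq_l2_bound:
  assumes p: "jacobi_seq a b z0 0 p" and q: "jacobi_seq a b z0 \<gamma> q"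
    and init: "p 0 * \<gamma> = 1" "q 0 = 0"
    and sum: "summable (\<lambda>k. (norm (p k))\<^sup>2)" "summable (\<lambda>k. (norm (q k))\<^sup>2)"
  obtains C where "\<And>u z \<alpha> n. jacobi_seq a b z \<alpha> u \<Longrightarrow> norm z \<le> R \<Longrightarrow>
      norm (\<alpha> * p 0) + norm (\<gamma> * u 0) \<le> X \<Longrightarrow> (\<Sum>k<n. (norm (u k))\<^sup>2) \<le> C"
proof -
  define h where "h k = norm (p k) + norm (q k)" for k
  define M where "M = (\<Sum>k. 2 * (norm (p k))\<^sup>2 + 2 * (norm (q k))\<^sup>2)"
  have M: "(\<Sum>k<n. (h k)\<^sup>2) \<le> M" for n
  proof -
    have "(h k)\<^sup>2 \<le> 2 * (norm (p k))\<^sup>2 + 2 * (norm (q k))\<^sup>2" for k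
      using zero_le_power2[of "norm (p k) - norm (q k)"] by (simp add: h_def power2_eq_square algebra_simps)
    then have "(\<Sum>k<n. (h k)\<^sup>2) \<le> (\<Sum>k<n. 2 * (norm (p k))\<^sup>2 + 2 * (norm (q k))\<^sup>2)"
      by (intro sum_mono)
    also have "\<dots> \<le> M"
      unfolding M_def by (intro sum_le_suminf summable_add summable_mult sum) auto
    finally show ?thesis .
  qed
  have "(\<Sum>k<n. (norm (u k))\<^sup>2) \<le> exp (2 * (X\<^sup>2 + (R + norm z0)\<^sup>2 * M) * M)"
    if u: "jacobi_seq a b z \<alpha> u" and z: "norm z \<le> R" and X: "norm (\<alpha> * p 0) + norm (\<gamma> * u 0) \<le> X"
    for u z \<alpha> n
  proof (rule discrete_gronwall_l2[where h=h])
    have R: "0 \<le> R" using z norm_ge_zero order_trans by blast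
    then show "0 \<le> R + norm z0" by simp
    show "0 \<le> X" using X norm_ge_zero by (meson add_nonneg_nonneg order_trans)
    show "0 \<le> h k" for k by (simp add: h_def)
    fix n
    have "norm (\<Sum>k<n. (p k * q n - p n * q k) * u k) \<le> (\<Sum>k<n. h n * (h k * norm (u k)))"
    proof (rule sum_norm_le)
      fix k
      have "norm (p k * q n - p n * q k) \<le> norm (p k) * norm (q n) + norm (p n) * norm (q k)"
        using norm_triangle_ineq4[of "p k * q n" "p n * q k"] by (simp add: norm_mult)
      also have "\<dots> \<le> h n * h k" by (simp add: h_def algebra_simps)
      finally show "norm ((p k * q n - p n * q k) * u k) \<le> h n * (h k * norm (u k))"
        by (simp add: norm_mult mult_right_mono mult.assoc[symmetric])
    qed
    then have 1: "norm ((z - z0) * (\<Sum>k<n. (p k * q n - p n * q k) * u k))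
        \<le> (R + norm z0) * (h n * (\<Sum>k<n. h k * norm (u k)))"
      unfolding norm_mult sum_distrib_left[symmetric]
      using z R norm_triangle_ineq4[of z z0] by (intro mult_mono) auto
    have 2: "norm (\<alpha> * p 0 * q n) + norm (\<gamma> * u 0 * p n) \<le> X * h n"
    proof -
      have "norm (\<alpha> * p 0 * q n) + norm (\<gamma> * u 0 * p n)
          \<le> norm (\<alpha> * p 0) * h n + norm (\<gamma> * u 0) * h n"
        unfolding norm_mult[of _ "q n"] norm_mult[of _ "p n"]
        by (intro add_mono mult_left_mono) (auto simp: h_def)
      also have "\<dots> \<le> X * h n"
        unfolding distrib_right[symmetric] using X by (intro mult_right_mono) (auto simp: h_def)
      finally show ?thesis .
    qed
    have "norm (u n) \<le> norm ((z - z0) * (\<Sum>k<n. (p k * q n - p n * q k) * u k))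
        + norm (\<alpha> * p 0 * q n) + norm (\<gamma> * u 0 * p n)"
      by (subst jacobi_seq_perturbation[OF p q init u]) (intro norm_triangle_le add_right_mono norm_triangle_ineq)
    with 1 2 show "norm (u n) \<le> h n * (X + (R + norm z0) * (\<Sum>k<n. h k * norm (u k)))"
      by (simp add: algebra_simps)
  qed (use M in auto)
  then show ?thesis by (rule that)
qed

text \<open>Cauchy-Schwarz on blocks of indices: the tails of c are small while the sums over f stay
  bounded on each disc. So the partial sums converge locally uniformly.\<close>

lemma l2_series:
  fixes c :: "nat \<Rightarrow> complex" and f :: "nat \<Rightarrow> complex \<Rightarrow> complex"
  assumes c: "summable (\<lambda>k. (norm (c k))\<^sup>2)"
    and hol: "\<And>k. f k holomorphic_on UNIV"
    and bd: "\<And>R. \<exists>C. \<forall>z n. norm z \<le> R \<longrightarrow> (\<Sum>k<n. (norm (f k z))\<^sup>2) \<le> C"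
  shows summable_l2_series: "summable (\<lambda>k. c k * f k z)"
    and holomorphic_l2_series: "(\<lambda>z. \<Sum>k. c k * f k z) holomorphic_on UNIV"
proof -
  let ?S = "\<lambda>n z. \<Sum>k<n. c k * f k z"
  have uc: "uniformly_convergent_on (cball 0 R) ?S" for R
  proof (rule Cauchy_uniformly_convergent, rule uniformly_Cauchy_onI')
    fix e :: real assume e: "0 < e"
    obtain C where C: "\<And>z n. norm z \<le> R \<Longrightarrow> (\<Sum>k<n. (norm (f k z))\<^sup>2) \<le> C"
      using bd by blast
    \<comment> \<open>Enlarged to be positive, so that it can divide e^2.\<close>
    define C' where "C' = \<bar>C\<bar> + 1"
    have C': "C' > 0" "C \<le> C'" by (auto simp: C'_def)
    obtain N where N: "\<And>m n. N \<le> m \<Longrightarrow> norm (\<Sum>k=m..<n. (norm (c k))\<^sup>2) < e\<^sup>2 / C'"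
      using c C' e unfolding summable_Cauchy by (meson divide_pos_pos zero_less_power)
    show "\<exists>M. \<forall>z\<in>cball 0 R. \<forall>m\<ge>M. \<forall>n>m. dist (?S m z) (?S n z) < e"
    proof (intro exI ballI allI impI)
      fix z :: complex and m n assume z: "z \<in> cball 0 R" and m: "N \<le> m" and n: "m < n"
      have "?S n z - ?S m z = (\<Sum>k=m..<n. c k * f k z)"
        using n by (simp add: sum_diff_nat_ivl lessThan_atLeast0)
      then have "dist (?S m z) (?S n z) = norm (\<Sum>k=m..<n. c k * f k z)"
        by (metis dist_commute dist_norm)
      then have "dist (?S m z) (?S n z) \<le> (\<Sum>k=m..<n. norm (c k) * norm (f k z))"
        by (simp add: norm_mult[symmetric] sum_norm_le)
      then have "(dist (?S m z) (?S n z))\<^sup>2 \<le> (\<Sum>k=m..<n. norm (c k) * norm (f k z))\<^sup>2"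
        by (intro power_mono) auto
      also have "\<dots> \<le> (\<Sum>k=m..<n. (norm (c k))\<^sup>2) * (\<Sum>k=m..<n. (norm (f k z))\<^sup>2)"
        by (rule Cauchy_Schwarz_ineq_sum)
      also have "\<dots> \<le> (\<Sum>k=m..<n. (norm (c k))\<^sup>2) * C'"
      proof (intro mult_left_mono sum_nonneg)
        have "(\<Sum>k=m..<n. (norm (f k z))\<^sup>2) \<le> (\<Sum>k<n. (norm (f k z))\<^sup>2)"
          by (intro sum_mono2) auto
        also have "\<dots> \<le> C'" using C[of z n] z C' by simp
        finally show "(\<Sum>k=m..<n. (norm (f k z))\<^sup>2) \<le> C'" .
      qed simp
      also have "\<dots> < e\<^sup>2 / C' * C'" using N[OF m, of n] C' by (intro mult_strict_right_mono) auto
      finally have "(dist (?S m z) (?S n z))\<^sup>2 < e\<^sup>2" using C' by simp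
      then show "dist (?S m z) (?S n z) < e" using e by (simp add: power2_less_imp_less)
    qed
  qed
  have ul: "uniform_limit (cball 0 R) ?S (\<lambda>z. \<Sum>k. c k * f k z) sequentially" for R
    using uc[of R] unfolding uniformly_convergent_uniform_limit_iff by (simp add: suminf_eq_lim)
  show "summable (\<lambda>k. c k * f k z)"
  proof -
    have "(\<lambda>n. ?S n z) \<longlonglongrightarrow> (\<Sum>k. c k * f k z)"
      by (rule tendsto_uniform_limitI[OF ul[of "norm z"]]) simp
    then show ?thesis unfolding summable_iff_convergent convergent_def by blast
  qed
  show "(\<lambda>z. \<Sum>k. c k * f k z) holomorphic_on UNIV"
  proof (rule holomorphic_uniform_sequence)
    show "?S n holomorphic_on UNIV" for n by (intro holomorphic_intros hol)
    fix z :: complex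
    have "uniform_limit (cball z 1) ?S (\<lambda>z. \<Sum>k. c k * f k z) sequentially"
      by (rule uniform_limit_on_subset[OF ul[of "norm z + 1"]])
         (auto simp: cball_subset_cball_iff)
    then show "\<exists>d>0. cball z d \<subseteq> UNIV \<and> uniform_limit (cball z d) ?S (\<lambda>z. \<Sum>k. c k * f k z) sequentially"
      by (intro exI[of _ 1]) auto
  qed simp
qed

section \<open>The Nevanlinna parametrization\<close>

text \<open>\<open>cpoly\<close> and \<open>second_kind\<close> both carry the recurrence over, but
  \<open>second_kind_pCons\<close> adds the integral of P_k. It is 0 for k > 0, by orthogonality to
  the constant P_0 = c, and \<gamma> = 1/c for k = 0.\<close>

lemma onp_jacobi_seq:
  assumes ind: "indeterminate t"
  obtains a b and \<gamma> :: real where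
    "\<And>z. jacobi_seq a b z 0 (\<lambda>k. onpP t k z)"
    "\<And>z. jacobi_seq a b z (complex_of_real \<gamma>) (\<lambda>k. onpQ t k z)"
    "\<And>z. onpP t 0 z * complex_of_real \<gamma> = 1" "\<And>z. onpQ t 0 z = 0"
proof -
  let ?\<rho> = "some_solution t"
  note sol = moment_solution_some_solution[OF ind]
  note on = orthonormal_polys_onp[OF ind sol]
  obtain a b where rec: "\<And>k. pCons 0 (onp t k) = smult (b k) (onp t (Suc k)) + smult (a k) (onp t k)
      + (if k = 0 then 0 else smult (b (k - 1)) (onp t (k - 1)))"
    using orthonormal_polys_recurrence[OF sol on] by blast
  define c where "c = coeff (onp t 0) 0"
  have "degree (onp t 0) = 0" "c > 0"
    using on by (auto simp: orthonormal_polys_def c_def) metis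
  then have P0: "onp t 0 = [:c:]" and c: "c > 0"
    by (auto simp: c_def elim!: degree_eq_zeroE)
  have int: "poly_integral ?\<rho> (onp t k) = (if k = 0 then 1 / c else 0)" for k
  proof -
    have "c * poly_integral ?\<rho> (onp t k) = poly_integral ?\<rho> (onp t k * onp t 0)"
      by (simp add: P0 poly_integral_smult[OF sol])
    also have "\<dots> = (if k = 0 then 1 else 0)" using on by (simp add: orthonormal_polys_iff)
    finally show ?thesis using c by (auto simp: field_simps split: if_splits)
  qed
  show ?thesis
  proof (rule that)
    fix z
    show "jacobi_seq a b z 0 (\<lambda>k. onpP t k z)"
      unfolding jacobi_seq_def
    proof
      fix k
      have "z * onpP t k z = cpoly (pCons 0 (onp t k)) z" by (simp add: onpP_def)
      then show "z * onpP t k z + (if k = 0 then 0 else 0) =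
         complex_of_real (b k) * onpP t (Suc k) z + complex_of_real (a k) * onpP t k z +
         (if k = 0 then 0 else complex_of_real (b (k - 1)) * onpP t (k - 1) z)"
        unfolding rec by (simp add: onpP_def)
    qed
    show "jacobi_seq a b z (complex_of_real (1 / c)) (\<lambda>k. onpQ t k z)"
      unfolding jacobi_seq_def
    proof
      fix k
      have "z * onpQ t k z + (if k = 0 then complex_of_real (1 / c) else 0)
          = second_kind ?\<rho> (pCons 0 (onp t k)) z"
        by (simp add: onpQ_def second_kind_pCons[OF sol] int)
      then show "z * onpQ t k z + (if k = 0 then complex_of_real (1 / c) else 0) =
         complex_of_real (b k) * onpQ t (Suc k) z + complex_of_real (a k) * onpQ t k z +
         (if k = 0 then 0 else complex_of_real (b (k - 1)) * onpQ t (k - 1) z)"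
        unfolding rec by (simp add: onpQ_def second_kind_add[OF sol] second_kind_smult[OF sol])
    qed
    show "onpP t 0 z * complex_of_real (1 / c) = 1" using c by (simp add: onpP_def P0)
    show "onpQ t 0 z = 0" by (simp add: onpQ_def P0 second_kind_def)
  qed
qed

section \<open>Locally uniform square summability of P_k and Q_k\<close>

lemma cnj_onpP_0: "cnj (onpP t k 0) = onpP t k 0"
  by (simp add: onpP_def cnj_cpoly)

lemma cnj_onpQ_0:
  assumes "indeterminate t"
  shows "cnj (onpQ t k 0) = onpQ t k 0"
  by (simp add: onpQ_def cnj_second_kind[OF moment_solution_some_solution[OF assms]])

lemma bessel_onp:
  assumes ind: "indeterminate t" and sol: "moment_solution t \<mu>" and z: "0 < Im z"
  shows "Im z * (\<Sum>k<n. (norm (stieltjes \<mu> z * onpP t k z + onpQ t k z))\<^sup>2) \<le> Im (stieltjes \<mu> z)"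
  using bessel_stieltjes[OF sol orthonormal_polys_onp[OF ind sol] z, of n]
  unfolding onpP_def onpQ_def second_kind_unique[OF moment_solution_some_solution[OF ind] sol] .

lemma summable_l2_linear_comb:
  fixes u v :: "nat \<Rightarrow> complex"
  assumes "summable (\<lambda>k. (norm (u k))\<^sup>2)" "summable (\<lambda>k. (norm (v k))\<^sup>2)"
  shows "summable (\<lambda>k. (norm (x * u k + y * v k))\<^sup>2)"
proof (rule summable_comparison_test')
  show "summable (\<lambda>k. 2 * ((norm x)\<^sup>2 * (norm (u k))\<^sup>2) + 2 * ((norm y)\<^sup>2 * (norm (v k))\<^sup>2))"
    by (intro summable_add summable_mult assms)
  fix k
  have "(norm (x * u k + y * v k))\<^sup>2 \<le> (norm (x * u k) + norm (y * v k))\<^sup>2"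
    by (intro power_mono norm_triangle_ineq) simp
  also have "\<dots> \<le> 2 * (norm (x * u k))\<^sup>2 + 2 * (norm (y * v k))\<^sup>2"
    using zero_le_power2[of "norm (x * u k) - norm (y * v k)"]
    by (simp add: power2_eq_square algebra_simps)
  finally show "norm ((norm (x * u k + y * v k))\<^sup>2)
      \<le> 2 * ((norm x)\<^sup>2 * (norm (u k))\<^sup>2) + 2 * ((norm y)\<^sup>2 * (norm (v k))\<^sup>2)"
    by (simp add: norm_mult power_mult_distrib)
qed

text \<open>At a point where two solutions have different Stieltjes transforms, Bessel's inequality for
  both makes \<open>P\<^sub>k\<close> and \<open>Q\<^sub>k\<close> square summable; the perturbation formula propagates this to the
  whole plane.\<close>

lemma onp_l2_bound:
  assumes ind: "indeterminate t"
  shows onpP_l2_bound: "\<exists>C. \<forall>z n. norm z \<le> R \<longrightarrow> (\<Sum>k<n. (norm (onpP t k z))\<^sup>2) \<le> C"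
    and onpQ_l2_bound: "\<exists>C. \<forall>z n. norm z \<le> R \<longrightarrow> (\<Sum>k<n. (norm (onpQ t k z))\<^sup>2) \<le> C"
proof -
  obtain a b \<gamma> where J: "\<And>z. jacobi_seq a b z 0 (\<lambda>k. onpP t k z)"
    "\<And>z. jacobi_seq a b z (complex_of_real \<gamma>) (\<lambda>k. onpQ t k z)"
    and init: "\<And>z. onpP t 0 z * complex_of_real \<gamma> = 1" "\<And>z. onpQ t 0 z = 0"
    using onp_jacobi_seq[OF ind] by blast
  have init': "complex_of_real \<gamma> * onpP t 0 z = 1" for z using init by (simp add: mult.commute)
  obtain \<mu> \<nu> w where sol: "moment_solution t \<mu>" "moment_solution t \<nu>" and w: "0 < Im w"
    and ne: "stieltjes \<mu> w \<noteq> stieltjes \<nu> w"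
    using indeterminate_stieltjes_neq[OF ind] by blast
  have y: "summable (\<lambda>k. (norm (stieltjes M w * onpP t k w + onpQ t k w))\<^sup>2)"
    if M: "moment_solution t M" for M
  proof (rule summableI_nonneg_bounded)
    show "(\<Sum>k<n. (norm (stieltjes M w * onpP t k w + onpQ t k w))\<^sup>2) \<le> Im (stieltjes M w) / Im w" for n
      using bessel_onp[OF ind M w, of n] w by (simp add: field_simps)
  qed simp
  define d where "d = stieltjes \<mu> w - stieltjes \<nu> w"
  have "d \<noteq> 0" using ne by (simp add: d_def)
  \<comment> \<open>Subtracting the two square summable sequences cancels Q_k and leaves d
    P_k(w).\<close>
  then have "onpP t k w = 1 / d * (stieltjes \<mu> w * onpP t k w + onpQ t k w)
      + (- 1 / d) * (stieltjes \<nu> w * onpP t k w + onpQ t k w)" for k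
    by (simp add: field_simps) (simp add: d_def algebra_simps)
  then have sP: "summable (\<lambda>k. (norm (onpP t k w))\<^sup>2)"
    using summable_l2_linear_comb[OF y[OF sol(1)] y[OF sol(2)], of "1 / d" "- 1 / d"] by simp
  have sQ: "summable (\<lambda>k. (norm (onpQ t k w))\<^sup>2)"
    using summable_l2_linear_comb[OF y[OF sol(1)] sP, of 1 "- stieltjes \<mu> w"] by simp
  \<comment> \<open>X = 1 fits both sequences: P has \<alpha> = 0 and \<gamma> P_0 = 1, while Q has
    \<alpha> = \<gamma>, \<gamma> P_0 = 1 and Q_0 = 0.\<close>
  obtain C where C: "\<And>u z \<alpha> n. jacobi_seq a b z \<alpha> u \<Longrightarrow> norm z \<le> R \<Longrightarrow>
      norm (\<alpha> * onpP t 0 w) + norm (complex_of_real \<gamma> * u 0) \<le> 1 \<Longrightarrow> (\<Sum>k<n. (norm (u k))\<^sup>2) \<le> C"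
    using jacobi_seq_l2_bound[OF J(1) J(2) init sP sQ, of R 1] by blast
  have "(\<Sum>k<n. (norm (onpP t k z))\<^sup>2) \<le> C" if "norm z \<le> R" for z n
    by (rule C[OF J(1) that]) (simp add: init')
  then show "\<exists>C. \<forall>z n. norm z \<le> R \<longrightarrow> (\<Sum>k<n. (norm (onpP t k z))\<^sup>2) \<le> C" by blast
  have "(\<Sum>k<n. (norm (onpQ t k z))\<^sup>2) \<le> C" if "norm z \<le> R" for z n
    by (rule C[OF J(2) that]) (simp add: init init')
  then show "\<exists>C. \<forall>z n. norm z \<le> R \<longrightarrow> (\<Sum>k<n. (norm (onpQ t k z))\<^sup>2) \<le> C" by blast
qed

section \<open>The Nevanlinna matrix: holomorphy, determinant and Weyl disc\<close>

lemma holomorphic_onpP: "onpP t k holomorphic_on S"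
  unfolding onpP_def[abs_def] by (rule holomorphic_cpoly)

lemma holomorphic_onpQ:
  assumes "indeterminate t"
  shows "onpQ t k holomorphic_on S"
  unfolding onpQ_def[abs_def]
  by (rule holomorphic_second_kind[OF moment_solution_some_solution[OF assms]])

lemma summable_onp_0:
  assumes ind: "indeterminate t"
  shows "summable (\<lambda>k. (norm (onpP t k 0))\<^sup>2)" "summable (\<lambda>k. (norm (onpQ t k 0))\<^sup>2)"
proof -
  show "summable (\<lambda>k. (norm (onpP t k 0))\<^sup>2)"
    using onpP_l2_bound[OF ind, of 0] by (auto intro: summableI_nonneg_bounded)
  show "summable (\<lambda>k. (norm (onpQ t k 0))\<^sup>2)"
    using onpQ_l2_bound[OF ind, of 0] by (auto intro: summableI_nonneg_bounded)
qed

lemma holomorphic_nev: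
  assumes ind: "indeterminate t"
  shows "nevA t holomorphic_on S" "nevB t holomorphic_on S"
    "nevC t holomorphic_on S" "nevD t holomorphic_on S"
proof -
  note s = summable_onp_0[OF ind]
  note P = holomorphic_l2_series[OF _ holomorphic_onpP onpP_l2_bound[OF ind]]
  note Q = holomorphic_l2_series[OF _ holomorphic_onpQ[OF ind] onpQ_l2_bound[OF ind]]
  have "nevA t holomorphic_on UNIV" "nevB t holomorphic_on UNIV"
    "nevC t holomorphic_on UNIV" "nevD t holomorphic_on UNIV"
    unfolding nevA_def[abs_def] nevB_def[abs_def] nevC_def[abs_def] nevD_def[abs_def]
    by (intro holomorphic_intros P Q s)+
  then show "nevA t holomorphic_on S" "nevB t holomorphic_on S"
    "nevC t holomorphic_on S" "nevD t holomorphic_on S"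
    using holomorphic_on_subset by blast+
qed

text \<open>The order of factors and the constants match the right-hand side of
  \<open>jacobi_seq_green\<close> at z and 0, so that identities at level n pass to the
  limit.\<close>

lemma nev_partial_sums_tendsto:
  assumes ind: "indeterminate t"
  shows "(\<lambda>n. z * (\<Sum>k\<le>n. onpQ t k z * onpQ t k 0)) \<longlonglongrightarrow> nevA t z"
    "(\<lambda>n. z * (\<Sum>k\<le>n. onpP t k z * onpQ t k 0) - 1) \<longlonglongrightarrow> nevB t z"
    "(\<lambda>n. z * (\<Sum>k\<le>n. onpQ t k z * onpP t k 0) + 1) \<longlonglongrightarrow> nevC t z"
    "(\<lambda>n. z * (\<Sum>k\<le>n. onpP t k z * onpP t k 0)) \<longlonglongrightarrow> nevD t z"
proof -
  note s = summable_onp_0[OF ind]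
  note P = summable_LIMSEQ'[OF summable_l2_series[OF _ holomorphic_onpP onpP_l2_bound[OF ind], where z=z]]
  note Q = summable_LIMSEQ'[OF summable_l2_series[OF _ holomorphic_onpQ[OF ind] onpQ_l2_bound[OF ind], where z=z]]
  show "(\<lambda>n. z * (\<Sum>k\<le>n. onpQ t k z * onpQ t k 0)) \<longlonglongrightarrow> nevA t z"
    using tendsto_mult_left[OF Q[OF s(2)], of z] by (simp add: nevA_def mult.commute)
  show "(\<lambda>n. z * (\<Sum>k\<le>n. onpP t k z * onpQ t k 0) - 1) \<longlonglongrightarrow> nevB t z"
    using tendsto_diff[OF tendsto_mult_left[OF P[OF s(2)], of z] tendsto_const[of 1]]
    by (simp add: nevB_def mult.commute)
  show "(\<lambda>n. z * (\<Sum>k\<le>n. onpQ t k z * onpP t k 0) + 1) \<longlonglongrightarrow> nevC t z"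
    using tendsto_add[OF tendsto_mult_left[OF Q[OF s(1)], of z] tendsto_const[of 1]]
    by (simp add: nevC_def mult.commute add.commute)
  show "(\<lambda>n. z * (\<Sum>k\<le>n. onpP t k z * onpP t k 0)) \<longlonglongrightarrow> nevD t z"
    using tendsto_mult_left[OF P[OF s(1)], of z] by (simp add: nevD_def mult.commute)
qed

text \<open>At level n the four partial sums are Casoratians between z and 0, with -1 and +1 as
  boundary terms of Green's identity. Their determinant factors into the Casoratians of P and Q at 0
  and at z, each equal to -1.\<close>

lemma nev_det:
  assumes ind: "indeterminate t"
  shows "nevA t z * nevD t z - nevB t z * nevC t z = 1"
proof -
  obtain a b \<gamma> where J: "\<And>z. jacobi_seq a b z 0 (\<lambda>k. onpP t k z)"
    "\<And>z. jacobi_seq a b z (complex_of_real \<gamma>) (\<lambda>k. onpQ t k z)"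
    and init: "\<And>z. onpP t 0 z * complex_of_real \<gamma> = 1" "\<And>z. onpQ t 0 z = 0"
    using onp_jacobi_seq[OF ind] by blast
  have init': "complex_of_real \<gamma> * onpP t 0 z = 1" for z using init by (simp add: mult.commute)
  define A B C D where "A n = z * (\<Sum>k\<le>n. onpQ t k z * onpQ t k 0)"
    and "B n = z * (\<Sum>k\<le>n. onpP t k z * onpQ t k 0) - 1"
    and "C n = z * (\<Sum>k\<le>n. onpQ t k z * onpP t k 0) + 1"
    and "D n = z * (\<Sum>k\<le>n. onpP t k z * onpP t k 0)" for n
  have fin: "A n * D n - B n * C n = 1" for n
  proof -
    let ?b = "complex_of_real (b n)"
    let ?P = "onpP t n z" and ?P' = "onpP t (Suc n) z" and ?Q = "onpQ t n z" and ?Q' = "onpQ t (Suc n) z"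
      and ?p = "onpP t n 0" and ?p' = "onpP t (Suc n) 0" and ?q = "onpQ t n 0" and ?q' = "onpQ t (Suc n) 0"
    have 1: "A n = ?b * (?Q' * ?q - ?Q * ?q')" "B n = ?b * (?P' * ?q - ?P * ?q')"
      "C n = ?b * (?Q' * ?p - ?Q * ?p')" "D n = ?b * (?P' * ?p - ?P * ?p')"
      using jacobi_seq_green[OF J(2)[of z] J(2)[of 0], of n] jacobi_seq_green[OF J(1)[of z] J(2)[of 0], of n]
        jacobi_seq_green[OF J(2)[of z] J(1)[of 0], of n] jacobi_seq_green[OF J(1)[of z] J(1)[of 0], of n]
      by (simp_all add: A_def B_def C_def D_def init init')
    have W: "?b * (onpP t (Suc n) w * onpQ t n w - onpP t n w * onpQ t (Suc n) w) = - 1" for w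
      using jacobi_seq_green[OF J(1)[of w] J(2)[of w], of n] by (simp add: init')
    have "A n * D n - B n * C n = (?b * (?p' * ?q - ?p * ?q')) * (?b * (?P' * ?Q - ?P * ?Q'))"
      unfolding 1 by (simp add: algebra_simps)
    then show ?thesis unfolding W by simp
  qed
  have "(\<lambda>n. A n * D n - B n * C n) \<longlonglongrightarrow> nevA t z * nevD t z - nevB t z * nevC t z"
    unfolding A_def B_def C_def D_def
    by (intro tendsto_intros nev_partial_sums_tendsto[OF ind])
  then show ?thesis unfolding fin using LIMSEQ_unique tendsto_const by blast
qed

text \<open>Membership of the transform in the Weyl disc, expressed through the Nevanlinna matrix: at level
  \<open>n\<close> the imaginary part below equals \<open>Im F(z) - Im z \<Sum>\<^sub>k |F(z) P\<^sub>k(z) + Q\<^sub>k(z)|\<^sup>2\<close>.\<close>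

lemma nev_Im_nonneg:
  assumes ind: "indeterminate t" and sol: "moment_solution t \<mu>" and z: "0 < Im z"
  defines "w \<equiv> stieltjes \<mu> z"
  shows "0 \<le> Im ((w * nevD t z + nevC t z) * cnj (w * nevB t z + nevA t z))"
proof -
  obtain a b \<gamma> where J: "\<And>z. jacobi_seq a b z 0 (\<lambda>k. onpP t k z)"
    "\<And>z. jacobi_seq a b z (complex_of_real \<gamma>) (\<lambda>k. onpQ t k z)"
    and init: "\<And>z. onpP t 0 z * complex_of_real \<gamma> = 1" "\<And>z. onpQ t 0 z = 0"
    using onp_jacobi_seq[OF ind] by blast
  have init': "complex_of_real \<gamma> * onpP t 0 z = 1" for z using init by (simp add: mult.commute)
  define A B C D where "A n = z * (\<Sum>k\<le>n. onpQ t k z * onpQ t k 0)"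
    and "B n = z * (\<Sum>k\<le>n. onpP t k z * onpQ t k 0) - 1"
    and "C n = z * (\<Sum>k\<le>n. onpQ t k z * onpP t k 0) + 1"
    and "D n = z * (\<Sum>k\<le>n. onpP t k z * onpP t k 0)" for n
  define y where "y k = w * onpP t k z + onpQ t k z" for k
  have Jy: "jacobi_seq a b z (complex_of_real \<gamma>) y"
    using jacobi_seq_add_scaled[OF J(1)[of z] J(2)[of z], of w] by (simp add: y_def[abs_def])
  have y0: "complex_of_real \<gamma> * y 0 = w"
    using init'[of z] by (simp add: y_def init mult.left_commute)
  have fin: "Im ((w * D n + C n) * cnj (w * B n + A n)) = Im w - Im z * (\<Sum>k<Suc n. (norm (y k))\<^sup>2)" for n
  proof -
    let ?b = "complex_of_real (b n)"
    let ?p = "onpP t n 0" and ?p' = "onpP t (Suc n) 0" and ?q = "onpQ t n 0" and ?q' = "onpQ t (Suc n) 0"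
    let ?S = "\<Sum>k<Suc n. (norm (y k))\<^sup>2"
    have V: "w * D n + C n = ?b * (y (Suc n) * ?p - y n * ?p')"
      using jacobi_seq_green[OF Jy J(1)[of 0], of n] init'
      by (simp add: C_def D_def y_def algebra_simps sum.distrib sum_distrib_left)
    have U: "w * B n + A n = ?b * (y (Suc n) * ?q - y n * ?q')"
      using jacobi_seq_green[OF Jy J(2)[of 0], of n]
      by (simp add: A_def B_def init init' y_def algebra_simps sum.distrib sum_distrib_left)
    have W: "?b * (?p' * ?q - ?p * ?q') = - 1"
      using jacobi_seq_green[OF J(1)[of 0] J(2)[of 0], of n] by (simp add: init')
    have y0': "complex_of_real \<gamma> * cnj (y 0) = cnj w"
      using arg_cong[OF y0, of cnj] by simp
    \<comment> \<open>Green's identity for y and its conjugate; the boundary term is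
      \<open>cnj w - w\<close> because \<gamma> y_0 = w.\<close>
    have Z: "?b * (y (Suc n) * cnj (y n) - y n * cnj (y (Suc n)))
        = (z - cnj z) * complex_of_real ?S - (w - cnj w)"
      using jacobi_seq_green[OF Jy jacobi_seq_cnj[OF Jy], of n]
      by (simp add: y0 y0' complex_norm_square[simplified of_real_power] lessThan_Suc_atMost del: sum.lessThan_Suc)
    let ?X = "(w * D n + C n) * cnj (w * B n + A n)"
    \<comment> \<open>The factorization from \<open>nev_det\<close> with y and its conjugate in
      place of P(z) and Q(z); the values at 0 are real, so conjugation only affects y.\<close>
    have "?X - cnj ?X = ?b * (y (Suc n) * cnj (y n) - y n * cnj (y (Suc n))) * (?b * (?p' * ?q - ?p * ?q'))"
      unfolding U V by (simp add: cnj_onpP_0 cnj_onpQ_0[OF ind] algebra_simps)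
    also have "\<dots> = (w - cnj w) - (z - cnj z) * complex_of_real ?S"
      unfolding W Z by simp
    finally have "Im (?X - cnj ?X) = Im ((w - cnj w) - (z - cnj z) * complex_of_real ?S)" by simp
    moreover have "Im (x - cnj x) = 2 * Im x" for x by simp
    moreover have "Im ((w - cnj w) - (z - cnj z) * complex_of_real x) = 2 * (Im w - Im z * x)" for x
      by simp
    ultimately show ?thesis by (metis mult_left_cancel zero_neq_numeral)
  qed
  have "(\<lambda>n. Im ((w * D n + C n) * cnj (w * B n + A n)))
      \<longlonglongrightarrow> Im ((w * nevD t z + nevC t z) * cnj (w * nevB t z + nevA t z))"
    unfolding A_def B_def C_def D_def
    by (intro tendsto_intros nev_partial_sums_tendsto[OF ind])
  moreover have "0 \<le> Im ((w * D n + C n) * cnj (w * B n + A n))" for n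
    unfolding fin using bessel_onp[OF ind sol z, of "Suc n"] by (simp add: y_def w_def del: sum.lessThan_Suc)
  ultimately show ?thesis by (intro LIMSEQ_le_const) auto
qed

lemma Im_divide_nonneg: "0 \<le> Im (x * cnj y) \<Longrightarrow> 0 \<le> Im (x / y)"
  by (simp add: complex_div_cnj[of x y] Im_divide_of_real)

lemma nevanlinna_representation:
  assumes ind: "indeterminate t" and sol: "moment_solution t \<mu>"
  shows "\<exists>\<phi>. nevanlinna_class \<phi> \<and> (\<forall>z. 0 < Im z \<longrightarrow> stieltjes \<mu> z = nev_transform t \<phi> z)"
proof -
  define H where "H = {z. 0 < Im z}"
  define F where "F = stieltjes \<mu>"
  define U where "U z = F z * nevB t z + nevA t z" for z
  define V where "V z = F z * nevD t z + nevC t z" for z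
  have H: "open H" "connected H"
    unfolding H_def by (auto simp: open_halfspace_Im_gt convex_halfspace_Im_gt intro: convex_connected)
  have holF: "F holomorphic_on H"
    unfolding F_def H_def by (rule holomorphic_stieltjes[OF moment_solutionD(1,2)[OF sol]])
  have holU: "U holomorphic_on H" and holV: "V holomorphic_on H"
    unfolding U_def[abs_def] V_def[abs_def] by (intro holomorphic_intros holF holomorphic_nev[OF ind])+
  have Im: "0 \<le> Im (V z * cnj (U z))" if "z \<in> H" for z
    using nev_Im_nonneg[OF ind sol, of z] that by (simp add: U_def V_def F_def H_def)
  have det: "nevA t z * nevD t z - nevB t z * nevC t z = 1" for z
    by (rule nev_det[OF ind])
  \<comment> \<open>(U, V) is the image of (F, 1) under a matrix of determinant -1, inverted here.
    The second identity also shows that U and V have no common zero.\<close>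
  have UV: "nevA t z * V z - nevC t z * U z = F z" "nevB t z * V z - nevD t z * U z = - 1" for z
  proof -
    have "nevA t z * V z - nevC t z * U z = F z * (nevA t z * nevD t z - nevB t z * nevC t z)"
      by (simp add: U_def V_def algebra_simps)
    then show "nevA t z * V z - nevC t z * U z = F z" by (simp add: det)
    have "nevB t z * V z - nevD t z * U z = - (nevA t z * nevD t z - nevB t z * nevC t z)"
      by (simp add: U_def V_def algebra_simps)
    then show "nevB t z * V z - nevD t z * U z = - 1" by (simp add: det)
  qed
  show ?thesis
  proof (cases "\<forall>z\<in>H. U z \<noteq> 0")
    case True
    let ?\<phi> = "\<lambda>z. V z / U z"
    have "nevanlinna_class (Some ?\<phi>)"
      unfolding nevanlinna_class_def
      using True Im holU holV Im_divide_nonneg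
      by (auto simp: H_def intro!: holomorphic_on_divide)
    moreover have "F z = nev_transform t (Some ?\<phi>) z" if "z \<in> H" for z
    proof -
      have U: "U z \<noteq> 0" using True that by blast
      have "nevA t z * ?\<phi> z - nevC t z = (nevA t z * V z - nevC t z * U z) / U z"
        "nevB t z * ?\<phi> z - nevD t z = (nevB t z * V z - nevD t z * U z) / U z"
        using U by (simp_all add: diff_divide_distrib)
      then have "nevA t z * ?\<phi> z - nevC t z = F z / U z" "nevB t z * ?\<phi> z - nevD t z = - 1 / U z"
        unfolding UV .
      then show ?thesis using U by (simp add: nev_transform_def)
    qed
    ultimately show ?thesis unfolding F_def H_def by blast
  next
    case False
    then obtain \<zeta> where \<zeta>: "\<zeta> \<in> H" "U \<zeta> = 0" by blast
    have "V \<zeta> \<noteq> 0" using UV(2)[of \<zeta>] \<zeta> by auto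
    moreover have "open (H \<inter> V -` (- {0}))"
      by (intro continuous_open_preimage holomorphic_on_imp_continuous_on holV H) auto
    ultimately obtain r where r: "r > 0" "ball \<zeta> r \<subseteq> H \<inter> V -` (- {0})"
      using \<zeta> open_contains_ball by (metis ComplI IntI singletonD vimageI)
    let ?\<psi> = "\<lambda>z. U z / V z"
    have hol\<psi>: "?\<psi> holomorphic_on ball \<zeta> r"
      using r(2) by (intro holomorphic_on_divide holomorphic_on_subset[OF holU] holomorphic_on_subset[OF holV]) auto
    have Im\<psi>: "Im (?\<psi> z) \<le> 0" if "z \<in> ball \<zeta> r" for z
    proof -
      have "0 \<le> Im (- U z * cnj (V z))" using Im[of z] that r(2) by (auto simp: algebra_simps)
      then have "0 \<le> Im (- U z / V z)" by (rule Im_divide_nonneg)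
      then show ?thesis by simp
    qed
    \<comment> \<open>U/V takes values in the closed lower half-plane and vanishes at \<zeta>. If
      nonconstant, it would be open and cover a disc around 0, including the point i e/2 of the
      upper half-plane.\<close>
    have "?\<psi> constant_on ball \<zeta> r"
    proof (rule ccontr)
      assume "\<not> ?\<psi> constant_on ball \<zeta> r"
      then have "open (?\<psi> ` ball \<zeta> r)"
        by (intro open_mapping_thm[OF hol\<psi>]) auto
      moreover have "0 \<in> ?\<psi> ` ball \<zeta> r" using \<zeta> r(1) by (intro image_eqI[of _ _ \<zeta>]) auto
      ultimately obtain e where e: "e > 0" "ball 0 e \<subseteq> ?\<psi> ` ball \<zeta> r"
        using open_contains_ball by blast
      have "\<i> * complex_of_real (e / 2) \<in> ball 0 e" using e(1) by (simp add: norm_mult)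
      then obtain z where "z \<in> ball \<zeta> r" "\<i> * complex_of_real (e / 2) = ?\<psi> z" using e(2) by blast
      then have "Im (\<i> * complex_of_real (e / 2)) \<le> 0" using Im\<psi> by metis
      then show False using e(1) by simp
    qed
    then obtain c where "\<And>z. z \<in> ball \<zeta> r \<Longrightarrow> ?\<psi> z = c" by (auto simp: constant_on_def)
    moreover from this[of \<zeta>] have "c = 0" using \<zeta> r(1) by simp
    ultimately have \<psi>0: "?\<psi> z = 0" if "z \<in> ball \<zeta> r" for z using that by simp
    have "U z = 0" if "z \<in> ball \<zeta> r" for z
      using \<psi>0[OF that] subsetD[OF r(2) that] by simp
    \<comment> \<open>Identity theorem: U vanishes on a disc, hence on the connected
      half-plane.\<close>
    then have U0: "U z = 0" if "z \<in> H" for z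
      using analytic_continuation_open[OF open_ball H(1) _ H(2) _ holU holomorphic_on_const, of \<zeta> r 0 z]
        that r by (simp add: subset_iff)
    have "F z = nev_transform t None z" if "z \<in> H" for z
    proof -
      have "nevB t z \<noteq> 0" using UV(2)[of z] U0[OF that] by auto
      moreover have "nevA t z = - (F z * nevB t z)"
        using U0[OF that] by (simp add: U_def eq_neg_iff_add_eq_0 add.commute)
      ultimately show ?thesis by (simp add: nev_transform_def)
    qed
    then show ?thesis unfolding F_def H_def by (intro exI[of _ None]) (simp add: nevanlinna_class_def)
  qed
qed

section \<open>Push-forward under x -> x^d and the theorem\<close>

lemma moment_solution_pushforward:
  fixes d l :: nat
  assumes sol: "moment_solution s \<sigma>" and l: "even l"
  defines "\<mu> \<equiv> distr (density \<sigma> (\<lambda>x. ennreal (x ^ l))) borel (\<lambda>x. x ^ d)"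
  shows "moment_solution (\<lambda>k. s (k * d + l)) \<mu>"
    and "stieltjes \<mu> z = (\<integral>x. complex_of_real (x ^ l) / (complex_of_real (x ^ d) - z) \<partial>\<sigma>)"
proof -
  have sets: "sets \<sigma> = sets borel" by (rule moment_solutionD(2)[OF sol])
  have m: "f \<in> borel_measurable \<sigma>" if "f \<in> borel_measurable borel" for f :: "real \<Rightarrow> 'b::topological_space"
    unfolding measurable_cong_sets[OF sets refl] by (rule that)
  \<comment> \<open>Evenness makes the weight nonnegative; a negative weight would be cut off to 0
    by \<open>ennreal\<close>.\<close>
  have nn: "0 \<le> x ^ l" for x :: real using l by (rule zero_le_even_power)
  have push: "(\<lambda>x. x ^ d) \<in> measurable (density \<sigma> (\<lambda>x. ennreal (x ^ l))) borel"
    unfolding measurable_cong_sets[OF sets_density refl] by (rule m) measurable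
  have int: "integral\<^sup>L \<mu> f = (\<integral>x. x ^ l *\<^sub>R f (x ^ d) \<partial>\<sigma>)"
    and intble: "integrable \<mu> f \<longleftrightarrow> integrable \<sigma> (\<lambda>x. x ^ l *\<^sub>R f (x ^ d))"
    if [measurable]: "f \<in> borel_measurable borel" for f :: "real \<Rightarrow> 'b::{banach, second_countable_topology}"
  proof -
    have f: "(\<lambda>x. f (x ^ d)) \<in> borel_measurable \<sigma>" by (rule m) measurable
    show "integral\<^sup>L \<mu> f = (\<integral>x. x ^ l *\<^sub>R f (x ^ d) \<partial>\<sigma>)"
      unfolding \<mu>_def using nn f by (subst integral_distr[OF push that], subst integral_density) (auto intro: m)
    show "integrable \<mu> f \<longleftrightarrow> integrable \<sigma> (\<lambda>x. x ^ l *\<^sub>R f (x ^ d))"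
      unfolding \<mu>_def using nn f by (subst integrable_distr_eq[OF push that], subst integrable_density) (auto intro: m)
  qed
  have mom: "(\<lambda>x. x ^ l *\<^sub>R (x ^ d) ^ k) = (\<lambda>x::real. x ^ (k * d + l))" for k
    by (simp add: power_add power_mult[symmetric] mult.commute)
  have moments: "integrable \<mu> (\<lambda>x. x ^ k)" "(\<integral>x. x ^ k \<partial>\<mu>) = s (k * d + l)" for k
    using moment_solutionD(4,5)[OF sol] by (simp_all only: int intble mom borel_measurable_power measurable_ident_sets)
  show "moment_solution (\<lambda>k. s (k * d + l)) \<mu>"
    unfolding moment_solution_def
  proof (intro conjI allI moments)
    show "sets \<mu> = sets borel" by (simp add: \<mu>_def)
    \<comment> \<open>The moment of order 0 is the total mass, so finiteness amounts to
      integrability of 1.\<close>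
    have "integrable \<mu> (\<lambda>x. 1 :: real)" using moments(1)[of 0] by simp
    then show "finite_measure \<mu>"
      by (intro finite_measureI) (auto simp: integrable_iff_bounded)
  qed
  have "stieltjes \<mu> z = (\<integral>x. x ^ l *\<^sub>R (1 / (complex_of_real (x ^ d) - z)) \<partial>\<sigma>)"
    unfolding stieltjes_def by (rule int) measurable
  then show "stieltjes \<mu> z = (\<integral>x. complex_of_real (x ^ l) / (complex_of_real (x ^ d) - z) \<partial>\<sigma>)"
    by (simp add: scaleR_conv_of_real)
qed

theorem mainTheorem9:
  fixes s :: "nat \<Rightarrow> real" and d l0 :: nat and \<sigma> :: "real measure"
  assumes "positive_seq s"
    and "d \<ge> 1"
    and "even l0"
    and "moment_solution s \<sigma>"
    and "indeterminate (\<lambda>k. s (k * d + l0))"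
  shows "\<exists>\<phi>. nevanlinna_class \<phi> \<and>
           (\<forall>z::complex. 0 < Im z \<longrightarrow>
              (\<integral>x. complex_of_real (x ^ l0) / (complex_of_real (x ^ d) - z) \<partial>\<sigma>)
                = nev_transform (\<lambda>k. s (k * d + l0)) \<phi> z)"
  using nevanlinna_representation[OF assms(5) moment_solution_pushforward(1)[OF assms(4,3)]]
  unfolding moment_solution_pushforward(2)[OF assms(4,3)] .

end
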